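(* Let $T_*\in\mathcal T(s)$ with $1\le s\le K$, let $\widehat A$ be any estimator of $A$ with columns in $\Delta_p$, and let $\widehat T$ be the corresponding plug-in estimator. Suppose that, for some $K\times K$ permutation matrix $P$, the events $$\bigcap_{j\in\overline J}\left\{\|\widehat A_{j\cdot}-(AP)_{j\cdot}\|_\infty\le\tfrac12\Pi_{*j}\right\}\quad\text{and}\quad\left\{\|\widehat A_{\underline J}-(AP)_{\underline J}\|_{1,\infty}\le\tfrac12\kappa(A_{\underline J},s)\right\}$$ hold (simultaneously) with probability $1-\alpha$. Then, with probability at least $1-4p^{-1}-\alpha$, $$\|\widehat T-P^\top T_*\|_1\le\frac{3}{\kappa^2(A_{\underline J},s)}\left\{\sqrt{\frac{2\rho\log p}{N}}+\frac{2\rho\log p}{3N}+16\rho\,\bigl\|\widehat A_{\overline J}-(AP)_{\overline J}\bigr\|_{1,\infty}+\frac{56}{3}\rho\sum_{j\in\overline J\setminus\underline J}\frac{\|\widehat A_{j\cdot}-(AP)_{j\cdot}\|_\infty}{\Pi_{*j}}\frac{\log p}{N}\right\}$$ (the right-hand side being $+\infty$ if $\kappa(A_{\underline J},s)=0$).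
   Context: Setting. $p>K\ge1$ and $N\ge 1$ are integers, $\Delta_d=\{x\in\mathbb R^d: x_j\ge 0\ \forall j,\ \sum_j x_j=1\}$. $A\in\mathbb R^{p\times K}$ is an unknown matrix whose columns belong to $\Delta_p$; for a matrix $M$, $M_{j\cdot}$ denotes its $j$-th row (as a column vector), $M_U$ the submatrix of rows in $U$, and $\|M\|_{1,\infty}=\max_k\|M_{\cdot k}\|_1$ the maximal column $\ell_1$-norm. $T_*\in\Delta_K$, $\Pi_*=AT_*\in\Delta_p$, and $X\in\mathbb R^p$ satisfies $NX\sim\mathrm{Multinomial}_p(N;\Pi_* )$. $\mathcal T(s)=\{T\in\Delta_K:|\mathrm{supp}(T)|=s\}$. Estimators. $\widehat A$ is any random $p\times K$ matrix with columns in $\Delta_p$ (no independence from $X$ is assumed). With $J=\{j\in[p]:X_j>0\}$, $\widehat T\in\arg\max_{T\in\Delta_K}N\sum_{j\in J}X_j\log(\widehat A_{j\cdot}^\top T)$. Quantities. $\overline J=\{j:\Pi_{*j}>0\}$; $\varepsilon_j=2\sqrt{\Pi_{*j}\log p/N}+\frac{4\log p}{3N}$; $\underline J=\{j:\Pi_{*j}>2\varepsilon_j\}$; $\rho=\max_{j\in\overline J}\|A_{j\cdot}\|_\infty/\Pi_{*j}$. For a matrix $M$ with $K$ columns, $$\kappa(M,s)=\min_{S\subseteq[K],\,|S|\le s}\ \min_{v\in\mathcal C(S)}\frac{\|Mv\|_1}{\|v\|_1},\qquad \mathcal C(S)=\{v\in\mathbb R^K\setminus\{0\}:\|v_S\|_1\ge\|v_{S^c}\|_1\}.$$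 *)

theory Defs
  imports "HOL-Probability.Probability"
begin

text \<open>
  A \<open>p \<times> K\<close> matrix has type \<^typ>\<open>real ^ 'k ^ 'p\<close>, with \<open>p = CARD('p)\<close> and \<open>K = CARD('k)\<close>;
  \<open>M $ j\<close> is its \<open>j\<close>-th row and \<open>M $ j $ k\<close> its \<open>(j, k)\<close> entry.
\<close>

definition prob_simplex :: "(real ^ 'n) set" where
  "prob_simplex = {x. (\<forall>j. 0 \<le> x $ j) \<and> (\<Sum>j\<in>UNIV. x $ j) = 1}"

definition sparse_simplex :: "nat \<Rightarrow> (real ^ 'n) set" where
  "sparse_simplex s = {T \<in> prob_simplex. card {k. T $ k \<noteq> 0} = s}"

definition permutation_matrix :: "real ^ 'n ^ 'n \<Rightarrow> bool" where
  "permutation_matrix P \<longleftrightarrow> (\<exists>\<pi>. bij \<pi> \<and> P = (\<chi> i j. if j = \<pi> i then 1 else 0))"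

definition l1norm :: "real ^ 'n \<Rightarrow> real" where
  "l1norm v = (\<Sum>i\<in>UNIV. \<bar>v $ i\<bar>)"

definition max_col_l1norm :: "real ^ 'k ^ 'p \<Rightarrow> real" where
  "max_col_l1norm M = Max (range (\<lambda>k. l1norm (column k M)))"

text \<open>
  The submatrix of the rows in \<open>U\<close> is represented with the rows outside \<open>U\<close> set to zero instead of
  deleted. Zero rows change neither the \<open>l1\<close> norms of the columns nor that of a product \<open>M *v v\<close>,
  the only quantities in which it is used.
\<close>

definition restrict_rows :: "'p set \<Rightarrow> real ^ 'k ^ 'p \<Rightarrow> real ^ 'k ^ 'p" where
  "restrict_rows U M = (\<chi> j. if j \<in> U then M $ j else 0)"

definition dominant_cone :: "'k set \<Rightarrow> (real ^ 'k) set" where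
  "dominant_cone S = {v. v \<noteq> 0 \<and> (\<Sum>k\<in>S. \<bar>v $ k\<bar>) \<ge> (\<Sum>k\<in>- S. \<bar>v $ k\<bar>)}"

text \<open>
  The two nested minima are merged into one infimum, because \<open>dominant_cone {}\<close> is empty: \<open>S = {}\<close>
  contributes nothing. For \<open>s \<ge> 1\<close> the infimum is over a nonempty set of nonnegative reals, and it
  is attained, the quotient being invariant under scaling of \<open>v\<close>.
\<close>

definition kappa :: "real ^ 'k ^ 'p \<Rightarrow> nat \<Rightarrow> real" where
  "kappa M s = Inf {l1norm (M *v v) / l1norm v | S v. card S \<le> s \<and> v \<in> dominant_cone S}"

definition J_over :: "real ^ 'p \<Rightarrow> 'p set" where
  "J_over q = {j. q $ j > 0}"

definition eps :: "nat \<Rightarrow> real ^ 'p \<Rightarrow> 'p \<Rightarrow> real" where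
  "eps N q j = 2 * sqrt (q $ j * ln (real CARD('p)) / real N)
    + 4 * ln (real CARD('p)) / (3 * real N)"

definition J_under :: "nat \<Rightarrow> real ^ 'p \<Rightarrow> 'p set" where
  "J_under N q = {j. q $ j > 2 * eps N q j}"

definition rho :: "real ^ 'k ^ 'p \<Rightarrow> real ^ 'p \<Rightarrow> real" where
  "rho A q = Max ((\<lambda>j. infnorm (A $ j) / q $ j) ` J_over q)"

definition multinomial_prob :: "nat \<Rightarrow> real ^ 'p \<Rightarrow> ('p \<Rightarrow> nat) \<Rightarrow> real" where
  "multinomial_prob N q c =
    (if (\<Sum>j\<in>UNIV. c j) = N
     then fact N / (\<Prod>j\<in>UNIV. fact (c j)) * (\<Prod>j\<in>UNIV. (q $ j) ^ c j) else 0)"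

text \<open>
  The masses \<open>multinomial_prob N q c\<close> sum to 1 for \<open>q\<close> in the simplex, so that the condition
  determines the law of \<open>Y\<close>.
\<close>

definition multinomial_distributed ::
    "'a measure \<Rightarrow> nat \<Rightarrow> real ^ 'p \<Rightarrow> ('a \<Rightarrow> real ^ 'p) \<Rightarrow> bool" where
  "multinomial_distributed M N q Y \<longleftrightarrow>
    Y \<in> borel_measurable M \<and>
    (\<forall>c. measure M {\<omega> \<in> space M. \<forall>j. Y \<omega> $ j = real (c j)} = multinomial_prob N q c)"

text \<open>The logarithm with \<open>log 0 = -\<infinity>\<close>; in the library \<open>ln 0 = 0\<close>.\<close>

definition ext_ln :: "real \<Rightarrow> ereal" where
  "ext_ln x = (if x > 0 then ereal (ln x) else - \<infinity>)"

definition plugin_loglik :: "nat \<Rightarrow> real ^ 'p \<Rightarrow> real ^ 'k ^ 'p \<Rightarrow> real ^ 'k \<Rightarrow> ereal" where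
  "plugin_loglik N x B T =
    ereal (real N) * (\<Sum>j\<in>{j. x $ j > 0}. ereal (x $ j) * ext_ln (B $ j \<bullet> T))"

end

theory Submission
  imports Defs
begin

text \<open>
  Relabel the columns of \<open>A\<close> so that \<open>P\<close> becomes the identity: this changes neither \<open>kappa\<close> nor
  \<open>rho\<close> (\<open>kappa_permuted\<close>, \<open>rho_permuted\<close>). Write \<open>q = A T\<close> for the cell probabilities, \<open>x\<close> for the
  observed frequencies, \<open>B\<close> for the estimated matrix, \<open>T_hat\<close> for the plug-in estimator and
  \<open>D = T_hat - T\<close>.

  The maximum likelihood property enters only through its first-order condition at \<open>T_hat\<close> in
  the direction of \<open>T\<close>, namely \<open>\<Sum>j. x j (B j \<bullet> D) / (B j \<bullet> T_hat) \<ge> 0\<close>. Subtracting this from the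
  same sum with denominators \<open>B j \<bullet> T\<close> gives (\<open>curvature_le\<close>)
  \<open>\<Sum>j. x j (B j \<bullet> D)\<^sup>2 / ((B j \<bullet> T) (B j \<bullet> T_hat)) \<le> \<Sum>j. x j (B j \<bullet> D) / (B j \<bullet> T)\<close>,
  a quantity quadratic in \<open>D\<close> bounded by one that is linear in \<open>D\<close>.

  The right-hand side is at most a multiple of the \<open>l1\<close> norm of \<open>D\<close> (\<open>score_le\<close>). Replacing
  \<open>B j / (B j \<bullet> T)\<close> by \<open>A j / q j\<close> costs the two estimation error terms of the theorem. What remains
  is the multinomial fluctuation \<open>\<Sum>j. (x j - q j) (A j \<bullet> D) / q j\<close> plus the sum of \<open>A j \<bullet> D\<close> over
  the cells of positive probability, and the latter is nonpositive because \<open>A T\<close> puts all its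
  mass on these cells.

  On the left-hand side only the cells \<open>J_under\<close> are kept, where \<open>x j \<ge> q j / 2\<close>. Cauchy-Schwarz
  bounds the square of the \<open>l1\<close> norm of \<open>B D\<close> on these cells by the left-hand side times a factor
  close to 2 (\<open>plugin_prediction_error\<close>). As \<open>D\<close> is a difference of points of the simplex, it lies in the
  cone of the support of \<open>T\<close>, so \<open>kappa\<close> converts the \<open>l1\<close> norm of \<open>A D\<close> into that of \<open>D\<close>.

  Passing between \<open>A\<close> and \<open>B\<close> produces correction factors which must not spoil the constant 3. They
  are harmless because the \<open>l1\<close> distance of two points of the simplex is at most 2: either the
  claimed bound is at least 2, or the column error of \<open>B\<close> is so small against \<open>kappa\<^sup>2 / rho\<close> that the
  corrections fit into the term \<open>16 rho\<close> times that error (\<open>plugin_error_le\<close>).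

  The probability of the required fluctuation bounds comes from Bernstein's inequality, applied
  with tail \<open>1 / p\<^sup>2\<close> to the single frequencies and to the weighted sums above, one for each column
  of \<open>A\<close>. There are at most \<open>2 p\<close> of these quantities, each with two tails, whence the total
  \<open>4 / p\<close> (\<open>good_counts_prob\<close>).
\<close>

section \<open>Bernstein's inequality for the multinomial distribution\<close>

definition count_vectors :: "nat \<Rightarrow> ('p::finite \<Rightarrow> nat) set" where
  "count_vectors N = {c. (\<Sum>j\<in>UNIV. c j) = N}"

lemma finite_count_vectors: "finite (count_vectors N :: ('p::finite \<Rightarrow> nat) set)"
proof (rule finite_subset)
  show "count_vectors N \<subseteq> (\<Pi>\<^sub>E j\<in>(UNIV :: 'p set). {..N})"
    by (auto simp: count_vectors_def member_le_sum)
  show "finite (\<Pi>\<^sub>E j\<in>(UNIV :: 'p set). {..N})"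
    by (intro finite_PiE) auto
qed

text \<open>
  The product of Poisson masses without the factors \<open>exp (- a j)\<close>. Splitting off \<open>fact N\<close> from a
  multinomial mass leaves this weight, whose behaviour under the increment of one count proves
  the multinomial theorem by induction on \<open>N\<close>.
\<close>
definition poisson_weight :: "('p::finite \<Rightarrow> real) \<Rightarrow> ('p \<Rightarrow> nat) \<Rightarrow> real" where
  "poisson_weight a c = (\<Prod>j\<in>UNIV. a j ^ c j / fact (c j))"

lemma poisson_weight_increment:
  "real (Suc (c i)) * poisson_weight a (c(i := Suc (c i))) = a i * poisson_weight a c"
proof -
  have "poisson_weight a (c(i := Suc (c i))) =
      a i ^ Suc (c i) / fact (Suc (c i)) * (\<Prod>j\<in>UNIV - {i}. a j ^ c j / fact (c j))"
    unfolding poisson_weight_def by (subst prod.remove[of _ i]) auto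
  moreover have "poisson_weight a c =
      a i ^ c i / fact (c i) * (\<Prod>j\<in>UNIV - {i}. a j ^ c j / fact (c j))"
    unfolding poisson_weight_def by (subst prod.remove[of _ i]) auto
  moreover have "real (Suc n) * (x ^ Suc n / fact (Suc n) * r) = x * (x ^ n / fact n * r)"
    for n :: nat and x r :: real
    by (simp del: of_nat_Suc)
  ultimately show ?thesis by metis
qed

text \<open>
  The multinomial theorem. In the induction step the total count \<open>Suc N\<close> is written as the sum of
  the single counts \<open>c i\<close>; by \<open>poisson_weight_increment\<close> lowering the count of cell \<open>i\<close> by one turns
  the \<open>i\<close>-th summand into \<open>a i\<close> times the sum for \<open>N\<close>.
\<close>
lemma sum_poisson_weight:
  "fact N * (\<Sum>c\<in>count_vectors N. poisson_weight a c) = (\<Sum>j\<in>UNIV. a j) ^ N"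
proof (induction N)
  case 0
  have "count_vectors 0 = {\<lambda>_ :: 'a. 0}"
    by (auto simp: count_vectors_def)
  then show ?case by (simp add: poisson_weight_def)
next
  case (Suc N)
  let ?C = "count_vectors :: nat \<Rightarrow> ('a \<Rightarrow> nat) set"
  have shift: "(\<Sum>c\<in>?C (Suc N). real (c i) * poisson_weight a c)
      = a i * (\<Sum>c\<in>?C N. poisson_weight a c)" for i
  proof -
    have *: "(\<Sum>j\<in>UNIV. (c(i := n)) j) = n + (\<Sum>j\<in>UNIV - {i}. c j)" for c :: "'a \<Rightarrow> nat" and n
      by (subst sum.remove[of _ i]) auto
    have **: "(\<Sum>j\<in>UNIV. c j) = c i + (\<Sum>j\<in>UNIV - {i}. c j)" for c :: "'a \<Rightarrow> nat"
      by (subst sum.remove[of _ i]) auto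
    have "(\<Sum>c\<in>?C (Suc N). real (c i) * poisson_weight a c)
        = (\<Sum>c\<in>{c \<in> ?C (Suc N). 0 < c i}. real (c i) * poisson_weight a c)"
      by (rule sum.mono_neutral_right) (auto simp: finite_count_vectors)
    also have "\<dots> = (\<Sum>c\<in>?C N. real (Suc (c i)) * poisson_weight a (c(i := Suc (c i))))"
      by (rule sum.reindex_bij_witness[where i = "\<lambda>c. c(i := Suc (c i))" and j = "\<lambda>c. c(i := c i - 1)"])
        (auto simp: count_vectors_def * ** simp del: of_nat_Suc fun_upd_apply,
         auto)
    also have "\<dots> = a i * (\<Sum>c\<in>?C N. poisson_weight a c)"
      by (simp only: poisson_weight_increment sum_distrib_left)
    finally show ?thesis .
  qed
  have "real (Suc N) * (\<Sum>c\<in>?C (Suc N). poisson_weight a c)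
      = (\<Sum>c\<in>?C (Suc N). \<Sum>i\<in>UNIV. real (c i) * poisson_weight a c)"
    unfolding sum_distrib_left
    by (intro sum.cong refl)
      (simp add: count_vectors_def sum_distrib_right[symmetric] of_nat_sum[symmetric] del: of_nat_sum)
  also have "\<dots> = (\<Sum>i\<in>UNIV. a i) * (\<Sum>c\<in>?C N. poisson_weight a c)"
    by (subst sum.swap) (simp add: shift sum_distrib_right)
  finally have "real (Suc N) * (\<Sum>c\<in>?C (Suc N). poisson_weight a c)
      = (\<Sum>i\<in>UNIV. a i) * (\<Sum>c\<in>?C N. poisson_weight a c)" .
  then have "fact (Suc N) * (\<Sum>c\<in>?C (Suc N). poisson_weight a c)
      = (\<Sum>i\<in>UNIV. a i) * (fact N * (\<Sum>c\<in>?C N. poisson_weight a c))"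
    by (simp add: mult_ac) 
  then show ?case using Suc by simp
qed

lemma multinomial_prob_eq_poisson_weight:
  "c \<in> count_vectors N \<Longrightarrow> multinomial_prob N q c = fact N * poisson_weight (($) q) c"
  by (simp add: multinomial_prob_def count_vectors_def poisson_weight_def prod_dividef)

lemma sum_multinomial_prob:
  "q \<in> prob_simplex \<Longrightarrow> (\<Sum>c\<in>count_vectors N. multinomial_prob N q c) = 1"
  using sum_poisson_weight[of N "($) q"]
  by (simp add: multinomial_prob_eq_poisson_weight sum_distrib_left prob_simplex_def)

lemma multinomial_prob_nonneg: "q \<in> prob_simplex \<Longrightarrow> 0 \<le> multinomial_prob N q c"
  by (auto simp: multinomial_prob_def prob_simplex_def intro!: mult_nonneg_nonneg divide_nonneg_nonneg prod_nonneg)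

text \<open>
  The factor \<open>exp (g j)\<close> per observation can be absorbed into the weight \<open>q $ j\<close>, so the moment
  generating function is again an instance of the multinomial theorem.
\<close>
lemma multinomial_mgf:
  "(\<Sum>c\<in>count_vectors N. multinomial_prob N q c * exp (\<Sum>j\<in>UNIV. real (c j) * g j))
    = (\<Sum>j\<in>UNIV. q $ j * exp (g j)) ^ N"
proof -
  have "multinomial_prob N q c * exp (\<Sum>j\<in>UNIV. real (c j) * g j)
      = fact N * poisson_weight (\<lambda>j. q $ j * exp (g j)) c" if "c \<in> count_vectors N" for c
    using that
    by (simp add: multinomial_prob_eq_poisson_weight poisson_weight_def exp_sum power_mult_distrib
        exp_of_nat_mult prod.distrib[symmetric] mult.assoc)
  then show ?thesis
    using sum_poisson_weight[of N "\<lambda>j. q $ j * exp (g j)"] by (simp add: sum_distrib_left)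
qed

text \<open>
  The exponential series is compared with a geometric one from the quadratic term on, using
  \<open>fact (n + 2) \<ge> 2 * 3 ^ n\<close>.
\<close>
lemma exp_le_bernstein:
  fixes y :: real
  assumes "\<bar>y\<bar> < 3"
  shows "exp y \<le> 1 + y + y\<^sup>2 / (2 * (1 - \<bar>y\<bar> / 3))"
proof -
  have fact_ge: "2 * 3 ^ n \<le> (fact (n + 2) :: real)" for n
  proof (induction n)
    case (Suc n)
    have "2 * 3 ^ Suc n = (3 :: real) * (2 * 3 ^ n)" by simp
    also have "\<dots> \<le> real (n + 3) * fact (n + 2)"
      using Suc by (intro mult_mono) auto
    also have "\<dots> = fact (Suc n + 2)" by (simp add: algebra_simps)
    finally show ?case .
  qed simp
  have sm: "summable (\<lambda>n. y ^ n / fact n)"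
    using summable_exp[of y] by (simp add: field_simps)
  have "exp y = (\<Sum>n. y ^ n / fact n)"
    by (simp add: exp_def divide_inverse scaleR_conv_of_real mult.commute)
  also have "\<dots> = (\<Sum>n. y ^ (n + 2) / fact (n + 2)) + (1 + y)"
    using suminf_split_initial_segment[OF sm, of 2] by (simp add: numeral_2_eq_2)
  also have "(\<Sum>n. y ^ (n + 2) / fact (n + 2)) \<le> (\<Sum>n. y\<^sup>2 / 2 * (\<bar>y\<bar> / 3) ^ n)"
  proof (rule suminf_le)
    show "y ^ (n + 2) / fact (n + 2) \<le> y\<^sup>2 / 2 * (\<bar>y\<bar> / 3) ^ n" for n
    proof -
      have "y ^ (n + 2) / fact (n + 2) \<le> \<bar>y\<bar> ^ (n + 2) / fact (n + 2)"
        using abs_ge_self[of "y ^ (n + 2)"] by (intro divide_right_mono) (simp_all only: power_abs fact_ge_zero)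
      also have "\<dots> \<le> \<bar>y\<bar> ^ (n + 2) / (2 * 3 ^ n)"
        using fact_ge by (intro divide_left_mono) auto
      also have "\<dots> = y\<^sup>2 / 2 * (\<bar>y\<bar> / 3) ^ n"
        by (simp add: power_add power_divide mult_ac power2_eq_square[symmetric])
      finally show ?thesis .
    qed
    show "summable (\<lambda>n. y ^ (n + 2) / fact (n + 2))"
      using sm summable_iff_shift[of "\<lambda>n. y ^ n / fact n" 2] by simp
    show "summable (\<lambda>n. y\<^sup>2 / 2 * (\<bar>y\<bar> / 3) ^ n)"
      using assms by (intro summable_mult summable_geometric) auto
  qed
  also have "(\<Sum>n. y\<^sup>2 / 2 * (\<bar>y\<bar> / 3) ^ n) = y\<^sup>2 / 2 * (1 / (1 - \<bar>y\<bar> / 3))"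
    using assms by (subst suminf_mult) (auto simp: summable_geometric suminf_geometric)
  finally show ?thesis by simp
qed

text \<open>
  The logarithmic moment generating function of one observation is of sub-gamma type. The second
  moment \<open>v\<close> may stand in for the variance because the mean is kept as a separate linear term.
\<close>
lemma mgf_le_bernstein:
  fixes q :: "real ^ 'p"
  assumes q: "q \<in> prob_simplex" and f: "\<And>j. \<bar>f j\<bar> \<le> b"
    and v: "(\<Sum>j\<in>UNIV. q $ j * (f j)\<^sup>2) \<le> v"
    and l: "0 \<le> l" "l * b < 3"
  shows "(\<Sum>j\<in>UNIV. q $ j * exp (l * f j))
    \<le> exp (l * (\<Sum>j\<in>UNIV. q $ j * f j) + l\<^sup>2 * v / (2 * (1 - l * b / 3)))"
proof -
  have qn: "0 \<le> q $ j" for j using q by (auto simp: prob_simplex_def)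
  let ?D = "2 * (1 - l * b / 3)"
  have "exp (l * f j) \<le> 1 + l * f j + l\<^sup>2 * (f j)\<^sup>2 / ?D" for j
  proof -
    have le: "\<bar>l * f j\<bar> \<le> l * b"
      using f l by (simp add: abs_mult mult_left_mono)
    have "exp (l * f j) \<le> 1 + l * f j + (l * f j)\<^sup>2 / (2 * (1 - \<bar>l * f j\<bar> / 3))"
      using le l by (intro exp_le_bernstein) linarith
    also have "(l * f j)\<^sup>2 / (2 * (1 - \<bar>l * f j\<bar> / 3)) \<le> (l * f j)\<^sup>2 / ?D"
      using le l by (intro divide_left_mono mult_pos_pos) auto
    finally show ?thesis by (simp add: power_mult_distrib)
  qed
  then have "(\<Sum>j\<in>UNIV. q $ j * exp (l * f j))
      \<le> (\<Sum>j\<in>UNIV. q $ j * (1 + l * f j + l\<^sup>2 * (f j)\<^sup>2 / ?D))"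
    by (intro sum_mono mult_left_mono qn)
  also have "\<dots> = 1 + l * (\<Sum>j\<in>UNIV. q $ j * f j) + l\<^sup>2 / ?D * (\<Sum>j\<in>UNIV. q $ j * (f j)\<^sup>2)"
    using q by (simp add: distrib_left sum.distrib sum_distrib_left sum_divide_distrib prob_simplex_def mult_ac)
  also have "\<dots> \<le> 1 + l * (\<Sum>j\<in>UNIV. q $ j * f j) + l\<^sup>2 / ?D * v"
    using v l by (intro add_left_mono mult_left_mono divide_nonneg_nonneg) (auto simp: mult.commute)
  also have "\<dots> \<le> exp (l * (\<Sum>j\<in>UNIV. q $ j * f j) + l\<^sup>2 / ?D * v)"
    using exp_ge_add_one_self[of "l * (\<Sum>j\<in>UNIV. q $ j * f j) + l\<^sup>2 / ?D * v"]
    by (simp only: add.assoc)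
  finally show ?thesis by simp
qed

text \<open>
  Bernstein's inequality with the tail parametrised by the exponent: Chernoff's method bounds the
  indicator of the deviation by an exponential. It is a statement about finite sums over count
  vectors, so no probability space is involved yet.
\<close>
lemma multinomial_bernstein:
  fixes q :: "real ^ 'p"
  assumes q: "q \<in> prob_simplex" and f: "\<And>j. \<bar>f j\<bar> \<le> b"
    and v: "(\<Sum>j\<in>UNIV. q $ j * (f j)\<^sup>2) \<le> v" "0 < v"
    and N: "0 < N" and y: "0 \<le> y"
  shows "(\<Sum>c | c \<in> count_vectors N \<and>
            sqrt (2 * v * y) + b * y / 3 \<le> (\<Sum>j\<in>UNIV. (real (c j) / real N - q $ j) * f j).
          multinomial_prob N q c) \<le> exp (- real N * y)"
proof -
  have b: "0 \<le> b" using f[of undefined] by linarith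
  \<comment> \<open>\<open>w\<close> is the minimiser for a sub-Gaussian tail; the denominator in \<open>l\<close> is the sub-gamma correction
    that makes the exponent below collapse to exactly \<open>- y\<close>.\<close>
  define w where "w = sqrt (2 * y / v)"
  define l where "l = w / (1 + b / 3 * w)"
  define \<mu> where "\<mu> = (\<Sum>j\<in>UNIV. q $ j * f j)"
  define t where "t = sqrt (2 * v * y) + b * y / 3"
  have w: "0 \<le> w" and y_eq: "y = w\<^sup>2 * v / 2"
    using v y by (auto simp: w_def)
  have "2 * v * y = (w * v)\<^sup>2" by (simp add: y_eq power2_eq_square)
  then have t_eq: "t = w * v + b * (w\<^sup>2 * v / 2) / 3"
    using w v by (simp add: t_def y_eq)
  have den: "0 < 1 + b / 3 * w"
    using w b by (intro add_pos_nonneg) auto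
  have l: "0 \<le> l" using w den by (simp add: l_def)
  have one_minus: "1 - l * b / 3 = 1 / (1 + b / 3 * w)"
    using den by (simp add: l_def field_simps)
  then have "0 < 1 - l * b / 3" using den by simp
  then have lb: "l * b < 3" by simp
  have exponent: "l\<^sup>2 * v / (2 * (1 - l * b / 3)) - l * t = - y"
  proof -
    define d where "d = 1 + b / 3 * w"
    have d: "d \<noteq> 0" "b * w = 3 * d - 3" using den by (auto simp: d_def)
    have "l\<^sup>2 * v / (2 * (1 - l * b / 3)) = w\<^sup>2 * v / (2 * d)"
    proof -
      have "1 - l * b / 3 = 1 / d" "l = w / d" using one_minus by (simp_all add: l_def d_def)
      then show ?thesis using d(1) by (simp only:) (simp add: field_simps power2_eq_square)
    qed
    moreover have "l * t = w\<^sup>2 * v * (1 + b * w / 6) / d"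
      unfolding t_eq l_def d_def[symmetric] by (simp add: algebra_simps add_divide_distrib power2_eq_square)
    moreover have "1 + b * w / 6 = (d + 1) / 2" using d by (simp add: field_simps)
    ultimately show ?thesis unfolding y_eq using d(1) by (simp only:) (simp add: field_simps)
  qed
  have "(\<Sum>c | c \<in> count_vectors N \<and>
            t \<le> (\<Sum>j\<in>UNIV. (real (c j) / real N - q $ j) * f j). multinomial_prob N q c)
      \<le> (\<Sum>c | c \<in> count_vectors N \<and>
            t \<le> (\<Sum>j\<in>UNIV. (real (c j) / real N - q $ j) * f j).
          multinomial_prob N q c * exp ((\<Sum>j\<in>UNIV. real (c j) * (l * f j)) - real N * l * (\<mu> + t)))"
  proof (rule sum_mono)
    fix c assume "c \<in> {c. c \<in> count_vectors N \<and>
            t \<le> (\<Sum>j\<in>UNIV. (real (c j) / real N - q $ j) * f j)}"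
    then have "\<mu> + t \<le> (\<Sum>j\<in>UNIV. real (c j) * f j) / real N"
      by (simp add: \<mu>_def left_diff_distrib sum_subtractf sum_divide_distrib)
    then have "real N * (\<mu> + t) \<le> (\<Sum>j\<in>UNIV. real (c j) * f j)"
      using N by (simp add: field_simps)
    then have "l * (real N * (\<mu> + t)) \<le> l * (\<Sum>j\<in>UNIV. real (c j) * f j)"
      using l by (intro mult_left_mono)
    then have "0 \<le> (\<Sum>j\<in>UNIV. real (c j) * (l * f j)) - real N * l * (\<mu> + t)"
      by (simp add: sum_distrib_left mult_ac)
    then have "multinomial_prob N q c * 1 \<le> multinomial_prob N q c *
        exp ((\<Sum>j\<in>UNIV. real (c j) * (l * f j)) - real N * l * (\<mu> + t))"
      using multinomial_prob_nonneg[OF q] by (intro mult_left_mono) auto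
    then show "multinomial_prob N q c \<le> multinomial_prob N q c *
        exp ((\<Sum>j\<in>UNIV. real (c j) * (l * f j)) - real N * l * (\<mu> + t))" by simp
  qed
  also have "\<dots> \<le> (\<Sum>c\<in>count_vectors N.
          multinomial_prob N q c * exp ((\<Sum>j\<in>UNIV. real (c j) * (l * f j)) - real N * l * (\<mu> + t)))"
    by (intro sum_mono2 finite_count_vectors) (auto simp: multinomial_prob_nonneg[OF q])
  also have "\<dots> = (\<Sum>j\<in>UNIV. q $ j * exp (l * f j)) ^ N * exp (- (real N * l * (\<mu> + t)))"
    unfolding multinomial_mgf[symmetric] sum_distrib_right
    by (simp add: exp_diff exp_minus divide_inverse mult_ac)
  also have "\<dots> \<le> exp (l * \<mu> + l\<^sup>2 * v / (2 * (1 - l * b / 3))) ^ N * exp (- (real N * l * (\<mu> + t)))"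
  proof (intro mult_right_mono power_mono)
    show "0 \<le> (\<Sum>j\<in>UNIV. q $ j * exp (l * f j))"
      using q by (auto simp: prob_simplex_def intro!: sum_nonneg)
  qed (use mgf_le_bernstein[OF q f v(1) l lb] in \<open>auto simp: \<mu>_def\<close>)
  also have "\<dots> = exp (real N * (l\<^sup>2 * v / (2 * (1 - l * b / 3)) - l * t))"
    by (simp add: exp_of_nat_mult[symmetric] exp_add[symmetric] algebra_simps)
  also have "\<dots> = exp (- real N * y)"
    unfolding exponent by simp
  finally show ?thesis unfolding t_def .
qed

section \<open>Column norms, simplices and the constant kappa\<close>

lemma l1norm_nonneg: "0 \<le> l1norm v"
  by (simp add: l1norm_def sum_nonneg)

lemma l1norm_pos: "v \<noteq> 0 \<Longrightarrow> 0 < l1norm v"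
  by (metis (no_types, lifting) UNIV_I abs_ge_zero abs_eq_0 finite l1norm_def l1norm_nonneg
      order_le_less sum_nonneg_eq_0_iff vec_eq_iff zero_index)

lemma l1norm_simplex: "T \<in> prob_simplex \<Longrightarrow> l1norm T = 1"
  by (simp add: l1norm_def prob_simplex_def)

lemma l1norm_diff_simplex_le_2:
  assumes "T \<in> prob_simplex" "T' \<in> prob_simplex"
  shows "l1norm (T - T') \<le> 2"
proof -
  have "l1norm (T - T') \<le> l1norm T + l1norm T'"
    unfolding l1norm_def sum.distrib[symmetric] by (intro sum_mono) (simp add: abs_triangle_ineq4)
  then show ?thesis using assms by (simp add: l1norm_simplex)
qed

lemma abs_inner_le_infnorm_l1norm: "\<bar>u \<bullet> v\<bar> \<le> infnorm u * l1norm v"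
proof -
  have "\<bar>u \<bullet> v\<bar> \<le> (\<Sum>i\<in>UNIV. \<bar>u $ i * v $ i\<bar>)"
    by (simp add: inner_vec_def sum_abs)
  also have "\<dots> \<le> (\<Sum>i\<in>UNIV. infnorm u * \<bar>v $ i\<bar>)"
    by (intro sum_mono) (simp add: abs_mult mult_right_mono component_le_infnorm_cart)
  finally show ?thesis by (simp add: l1norm_def sum_distrib_left)
qed

lemma restrict_rows_diff: "restrict_rows U B - restrict_rows U A = restrict_rows U (B - A)"
  by (simp add: restrict_rows_def vec_eq_iff)

lemma l1norm_restrict_rows_mult: "l1norm (restrict_rows U C *v v) = (\<Sum>j\<in>U. \<bar>C $ j \<bullet> v\<bar>)"
proof -
  have "l1norm (restrict_rows U C *v v) = (\<Sum>j\<in>UNIV. if j \<in> U then \<bar>C $ j \<bullet> v\<bar> else 0)"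
    unfolding l1norm_def
    by (intro sum.cong) (auto simp: matrix_vector_mul_component restrict_rows_def)
  then show ?thesis by (simp add: sum.If_cases)
qed

lemma l1norm_mult_le_max_col_l1norm: "l1norm (C *v v) \<le> max_col_l1norm C * l1norm v"
proof -
  have col: "(\<Sum>j\<in>UNIV. \<bar>C $ j $ k\<bar>) \<le> max_col_l1norm C" for k
    unfolding max_col_l1norm_def by (rule Max_ge) (auto simp: l1norm_def column_def)
  have "l1norm (C *v v) \<le> (\<Sum>j\<in>UNIV. \<Sum>k\<in>UNIV. \<bar>C $ j $ k\<bar> * \<bar>v $ k\<bar>)"
    unfolding l1norm_def matrix_vector_mult_def
    by (auto intro!: sum_mono order_trans[OF sum_abs] simp: abs_mult)
  also have "\<dots> = (\<Sum>k\<in>UNIV. (\<Sum>j\<in>UNIV. \<bar>C $ j $ k\<bar>) * \<bar>v $ k\<bar>)"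
    by (subst sum.swap) (simp add: sum_distrib_right)
  also have "\<dots> \<le> (\<Sum>k\<in>UNIV. max_col_l1norm C * \<bar>v $ k\<bar>)"
    by (intro sum_mono mult_right_mono col) auto
  finally show ?thesis by (simp add: l1norm_def sum_distrib_left)
qed

lemma max_col_l1norm_nonneg: "0 \<le> max_col_l1norm C"
  unfolding max_col_l1norm_def by (subst Max_ge_iff) (auto simp: l1norm_nonneg)

lemma matrix_mult_simplex:
  assumes cols: "\<forall>k. column k A \<in> prob_simplex" and T: "T \<in> prob_simplex"
  shows "A *v T \<in> prob_simplex"
proof -
  have "(\<Sum>j\<in>UNIV. (A *v T) $ j) = (\<Sum>k\<in>UNIV. (\<Sum>j\<in>UNIV. A $ j $ k) * T $ k)"
    unfolding matrix_vector_mult_def by (simp, subst sum.swap) (simp add: sum_distrib_right)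
  then show ?thesis using assms
    by (auto simp: prob_simplex_def column_def matrix_vector_mult_def intro!: sum_nonneg)
qed

lemma kappa_bdd_below:
  "bdd_below {l1norm (M *v v) / l1norm v | S v. card S \<le> s \<and> v \<in> dominant_cone S}"
  by (rule bdd_belowI[of _ 0]) (auto simp: l1norm_nonneg)

lemma kappa_mult_l1norm_le:
  assumes "card S \<le> s" "v \<in> dominant_cone S"
  shows "kappa M s * l1norm v \<le> l1norm (M *v v)"
proof -
  have "kappa M s \<le> l1norm (M *v v) / l1norm v"
    unfolding kappa_def using assms by (intro cInf_lower kappa_bdd_below) auto
  moreover have "0 < l1norm v" using assms by (auto simp: dominant_cone_def l1norm_pos)
  ultimately show ?thesis by (simp add: pos_le_divide_eq)
qed

lemma axis_in_dominant_cone: "axis k 1 \<in> dominant_cone {k}"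
  by (auto simp: dominant_cone_def axis_def vec_eq_iff)

lemma kappa_nonneg: "1 \<le> s \<Longrightarrow> 0 \<le> kappa M s"
  unfolding kappa_def
proof (rule cInf_greatest)
  assume "1 \<le> s"
  have "axis undefined 1 \<in> dominant_cone {undefined :: 'a}" by (rule axis_in_dominant_cone)
  with \<open>1 \<le> s\<close> show "{l1norm (M *v v) / l1norm v | S v. card S \<le> s \<and> v \<in> dominant_cone S} \<noteq> {}"
    by (force intro: exI[of _ "{undefined :: 'a}"])
qed (auto simp: l1norm_nonneg)

text \<open>
  A coordinate vector lies in the cone of its own coordinate, and its image is a column of \<open>A\<close>,
  a probability vector.
\<close>
lemma kappa_le_1:
  fixes A :: "real ^ 'k ^ 'p"
  assumes cols: "\<forall>k. column k A \<in> prob_simplex" and s: "1 \<le> s"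
  shows "kappa (restrict_rows U A) s \<le> 1"
proof -
  let ?e = "axis undefined 1 :: real ^ 'k"
  have e: "?e \<in> prob_simplex" by (auto simp: prob_simplex_def axis_def)
  have "kappa (restrict_rows U A) s * l1norm ?e \<le> l1norm (restrict_rows U A *v ?e)"
    by (rule kappa_mult_l1norm_le[OF _ axis_in_dominant_cone]) (use s in auto)
  also have "\<dots> \<le> (\<Sum>j\<in>UNIV. \<bar>A $ j \<bullet> ?e\<bar>)"
    unfolding l1norm_restrict_rows_mult by (rule sum_mono2) auto
  also have "\<dots> = l1norm (A *v ?e)"
    by (simp add: l1norm_def matrix_vector_mul_component)
  also have "\<dots> = 1" by (intro l1norm_simplex matrix_mult_simplex cols e)
  finally show ?thesis by (simp add: l1norm_simplex[OF e])
qed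

text \<open>
  Off the support of \<open>T\<close> the difference is nonnegative, and its coordinates add up to zero. Its
  \<open>l1\<close> norm off the support is therefore minus its sum on the support.
\<close>
lemma simplex_diff_in_dominant_cone:
  assumes T: "T \<in> prob_simplex" and T': "T' \<in> prob_simplex" and ne: "T' \<noteq> T"
  shows "T' - T \<in> dominant_cone {k. T $ k \<noteq> 0}"
proof -
  let ?S = "{k. T $ k \<noteq> 0}"
  have "(\<Sum>k\<in>?S. (T' - T) $ k) + (\<Sum>k\<in>- ?S. (T' - T) $ k) = (\<Sum>k\<in>UNIV. (T' - T) $ k)"
    by (subst sum.union_disjoint[symmetric]) (auto intro: sum.cong)
  also have "\<dots> = 0" using T T' by (simp add: prob_simplex_def sum_subtractf)
  finally have "(\<Sum>k\<in>- ?S. (T' - T) $ k) = - (\<Sum>k\<in>?S. (T' - T) $ k)" by linarith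
  moreover have "(\<Sum>k\<in>- ?S. \<bar>(T' - T) $ k\<bar>) = (\<Sum>k\<in>- ?S. (T' - T) $ k)"
    using T' by (intro sum.cong) (auto simp: prob_simplex_def)
  moreover have "\<bar>\<Sum>k\<in>?S. (T' - T) $ k\<bar> \<le> (\<Sum>k\<in>?S. \<bar>(T' - T) $ k\<bar>)" by (rule sum_abs)
  ultimately have "(\<Sum>k\<in>- ?S. \<bar>(T' - T) $ k\<bar>) \<le> (\<Sum>k\<in>?S. \<bar>(T' - T) $ k\<bar>)" by linarith
  then show ?thesis using ne by (simp add: dominant_cone_def)
qed

lemma infnorm_row_le_rho:
  assumes "0 < q $ j"
  shows "infnorm (A $ j) \<le> rho A q * q $ j"
proof -
  have "infnorm (A $ j) / q $ j \<le> rho A q"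
    unfolding rho_def using assms by (intro Max_ge) (auto simp: J_over_def)
  then show ?thesis using assms by (simp add: pos_divide_le_eq)
qed

text \<open>
  Each \<open>(A *v T) $ j\<close> is an average of the entries of row \<open>j\<close>, hence at most their maximum.
\<close>
lemma rho_ge_1:
  assumes T: "T \<in> prob_simplex" and q: "A *v T \<in> prob_simplex"
  shows "1 \<le> rho A (A *v T)"
proof -
  have "\<exists>j. 0 < (A *v T) $ j"
  proof (rule ccontr)
    assume "\<not> ?thesis"
    then have "(\<Sum>j\<in>UNIV. (A *v T) $ j) \<le> 0" by (intro sum_nonpos) (auto simp: not_less)
    then show False using q by (auto simp: prob_simplex_def)
  qed
  then obtain j where j: "0 < (A *v T) $ j" by blast
  have "(A *v T) $ j \<le> infnorm (A $ j)"
    using abs_inner_le_infnorm_l1norm[of "A $ j" T] by (simp add: matrix_vector_mul_component l1norm_simplex[OF T])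
  also have "\<dots> \<le> rho A (A *v T) * (A *v T) $ j" by (rule infnorm_row_le_rho[where q = "A *v T", OF j])
  finally show ?thesis using j by simp
qed

lemma eps_nonneg: "0 \<le> q $ j \<Longrightarrow> 0 \<le> eps N q j"
  for q :: "real ^ 'p"
proof -
  assume "0 \<le> q $ j"
  moreover have "0 \<le> ln (real CARD('p))"
    by (intro ln_ge_zero) (simp add: Suc_leI)
  ultimately show ?thesis by (simp add: eps_def)
qed

text \<open>
  The square root is split by the arithmetic-geometric mean inequality. This makes \<open>x $ j / q $ j\<close>
  at most 2 plus a multiple of \<open>1 / q $ j\<close> on the cells of small probability, the source of the
  last term of the error bound.
\<close>
lemma eps_le:
  fixes q :: "real ^ 'p"
  assumes "0 \<le> q $ j"
  shows "eps N q j \<le> q $ j + 7 / 3 * (ln (real CARD('p)) / real N)"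
proof -
  define L where "L = ln (real CARD('p)) / real N"
  have L: "0 \<le> L" unfolding L_def by (intro divide_nonneg_nonneg ln_ge_zero) (simp_all add: Suc_leI)
  have "2 * sqrt (q $ j * L) \<le> q $ j + L"
    using arith_geo_mean_sqrt[OF assms L] by simp
  then show ?thesis by (simp add: eps_def L_def)
qed

section \<open>First-order optimality of the plug-in estimator\<close>

lemma plugin_loglik_finite:
  assumes "\<And>j. 0 < x $ j \<Longrightarrow> 0 < B $ j \<bullet> T"
  shows "plugin_loglik N x B T = ereal (real N * (\<Sum>j | 0 < x $ j. x $ j * ln (B $ j \<bullet> T)))"
  using assms by (simp add: plugin_loglik_def ext_ln_def)

lemma plugin_loglik_minus_infinity:
  assumes "0 < N" "0 < x $ j" "\<not> 0 < B $ j \<bullet> T"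
  shows "plugin_loglik N x B T = - \<infinity>"
proof -
  have "(\<Sum>j\<in>{j. x $ j > 0}. ereal (x $ j) * ext_ln (B $ j \<bullet> T)) = - \<infinity>"
  proof -
    have "ereal (x $ i) * ext_ln (B $ i \<bullet> T) \<noteq> \<infinity>" if "0 < x $ i" for i
      using that by (simp add: ext_ln_def)
    then have "(\<Sum>j\<in>{j. x $ j > 0}. ereal (x $ j) * ext_ln (B $ j \<bullet> T)) \<noteq> \<infinity>"
      by (auto simp: sum_Pinfty)
    moreover have "ereal (x $ j) * ext_ln (B $ j \<bullet> T) = - \<infinity>"
      using assms by (simp add: ext_ln_def)
    ultimately show ?thesis
      using assms by (subst sum.remove[of _ j]) (auto simp: sum_Pinfty ext_ln_def)
  qed
  then show ?thesis using assms by (simp add: plugin_loglik_def)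
qed

text \<open>
  The log-likelihood is finite at \<open>T\<close>, so it is finite at the maximiser as well, which makes all
  fitted probabilities of observed cells positive. Along the segment from the maximiser to \<open>T\<close>
  the log-likelihood is then differentiable at the maximiser, where its slope cannot be positive.
\<close>
lemma plugin_mle_first_order:
  assumes max: "is_arg_max (plugin_loglik N x B) (\<lambda>T. T \<in> prob_simplex) Tb"
    and N: "0 < N" and T: "T \<in> prob_simplex"
    and T_pos: "\<And>j. 0 < x $ j \<Longrightarrow> 0 < B $ j \<bullet> T"
  shows "\<And>j. 0 < x $ j \<Longrightarrow> 0 < B $ j \<bullet> Tb"
    and "(\<Sum>j | 0 < x $ j. x $ j * (B $ j \<bullet> (T - Tb)) / (B $ j \<bullet> Tb)) \<le> 0"
proof -
  have Tb: "Tb \<in> prob_simplex" using max by (simp add: is_arg_max_def)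
  have le: "plugin_loglik N x B T' \<le> plugin_loglik N x B Tb" if "T' \<in> prob_simplex" for T'
    using max that by (meson is_arg_max_linorder)
  show Tb_pos: "0 < B $ j \<bullet> Tb" if "0 < x $ j" for j
  proof (rule ccontr)
    assume "\<not> 0 < B $ j \<bullet> Tb"
    then have "plugin_loglik N x B T = - \<infinity>"
      using plugin_loglik_minus_infinity[of N x j B Tb] N that le[OF T] by simp
    then show False using plugin_loglik_finite[OF T_pos, where N = N] by simp
  qed
  define f where "f t = (\<Sum>j | 0 < x $ j. x $ j * ln (B $ j \<bullet> Tb + t * (B $ j \<bullet> (T - Tb))))" for t
  have seg: "B $ j \<bullet> Tb + t * (B $ j \<bullet> (T - Tb)) = B $ j \<bullet> ((1 - t) *\<^sub>R Tb + t *\<^sub>R T)" for j t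
    by (simp add: inner_add_right inner_diff_right algebra_simps)
  have f_le: "f t \<le> f 0" if t: "0 \<le> t" "t < 1" for t
  proof -
    let ?T = "(1 - t) *\<^sub>R Tb + t *\<^sub>R T"
    have "?T \<in> prob_simplex"
      using t T Tb by (simp add: prob_simplex_def sum.distrib sum_distrib_left[symmetric])
    moreover have pos: "0 < B $ j \<bullet> ?T" if "0 < x $ j" for j
      using Tb_pos[OF that] T_pos[OF that] t
      by (simp add: inner_add_right add_pos_nonneg)
    ultimately show ?thesis
      using le[of ?T] N
      by (simp add: plugin_loglik_finite[OF pos] plugin_loglik_finite[OF Tb_pos] f_def seg)
  qed
  let ?d = "\<Sum>j | 0 < x $ j. x $ j * (B $ j \<bullet> (T - Tb)) / (B $ j \<bullet> Tb)"
  have der: "(f has_real_derivative ?d) (at 0)"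
    unfolding f_def using Tb_pos
    by (auto intro!: derivative_eq_intros sum.cong simp: field_simps)
  show "?d \<le> 0"
  proof (rule ccontr)
    assume "\<not> ?d \<le> 0"
    then obtain d where "0 < d" "\<And>h. 0 < h \<Longrightarrow> h < d \<Longrightarrow> f 0 < f (0 + h)"
      using DERIV_pos_inc_right[OF der] by auto
    moreover have "0 < min (d / 2) (1 / 2)" "min (d / 2) (1 / 2) < d" "min (d / 2) (1 / 2) < 1"
      using \<open>0 < d\<close> by auto
    ultimately show False using f_le[of "min (d / 2) (1 / 2)"] by fastforce
  qed
qed

section \<open>The error bound for small multinomial fluctuations\<close>

text \<open>
  The deterministic situation for one outcome, with columns already relabelled: \<open>x\<close> are the
  observed frequencies, \<open>B\<close> is the estimate of \<open>A\<close> and \<open>T_hat\<close> that of \<open>T\<close>. The frequencies and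
  the weighted sums \<open>noise\<close> are assumed to deviate from their means only within Bernstein's bounds.
\<close>
locale plugin_good_event =
  fixes N s :: nat and A B :: "real ^ 'k ^ 'p" and T T_hat :: "real ^ 'k" and q x :: "real ^ 'p"
  assumes N_pos: "0 < N" and s_pos: "1 \<le> s"
    and A_cols: "\<forall>k. column k A \<in> prob_simplex"
    and B_cols: "\<forall>k. column k B \<in> prob_simplex"
    and T_sparse: "T \<in> sparse_simplex s"
    and q_eq: "q = A *v T"
    and maximizer: "is_arg_max (plugin_loglik N x B) (\<lambda>T. T \<in> prob_simplex) T_hat"
    and row_error: "\<And>j. j \<in> J_over q \<Longrightarrow> infnorm (B $ j - A $ j) \<le> q $ j / 2"
    and x_nonneg: "\<And>j. 0 \<le> x $ j"
    and x_support: "\<And>j. j \<notin> J_over q \<Longrightarrow> x $ j = 0"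
    and x_upper: "\<And>j. x $ j \<le> q $ j + eps N q j"
    and x_lower: "\<And>j. q $ j - eps N q j \<le> x $ j"
    and noise: "\<And>k. \<bar>\<Sum>j\<in>UNIV. (x $ j - q $ j) * (A $ j $ k / q $ j)\<bar>
      \<le> sqrt (4 * rho A q * (ln (real CARD('p)) / real N)) + 2 / 3 * rho A q * (ln (real CARD('p)) / real N)"
begin

abbreviation "J_pos \<equiv> J_over q"
abbreviation "J_large \<equiv> J_under N q"
abbreviation "\<rho> \<equiv> rho A q"

definition "log_rate = ln (real CARD('p)) / real N"
definition "err = l1norm (T_hat - T)"
definition "col_err = max_col_l1norm (restrict_rows J_pos B - restrict_rows J_pos A)"
definition "small_row_err = (\<Sum>j\<in>J_pos - J_large. infnorm (B $ j - A $ j) / q $ j * log_rate)"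
definition "noise_level = sqrt (4 * \<rho> * log_rate) + 2 / 3 * \<rho> * log_rate"

text \<open>
  \<open>score_bound\<close> is the slope in \<open>score_le\<close>, where \<open>noise_level\<close> comes from the multinomial
  fluctuation and the other two terms come from the error of \<open>B\<close>.
\<close>
definition "score_bound = noise_level + 8 * \<rho> * col_err + 28 / 3 * \<rho> * small_row_err"

lemma T_simplex: "T \<in> prob_simplex" using T_sparse by (simp add: sparse_simplex_def)
lemma T_hat_simplex: "T_hat \<in> prob_simplex" using maximizer by (simp add: is_arg_max_def)
lemma q_simplex: "q \<in> prob_simplex" unfolding q_eq by (rule matrix_mult_simplex[OF A_cols T_simplex])
lemma q_nonneg: "0 \<le> q $ j" using q_simplex by (simp add: prob_simplex_def)
lemma q_component: "q $ j = A $ j \<bullet> T" by (simp add: q_eq matrix_vector_mul_component)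
lemma \<rho>_ge_1: "1 \<le> \<rho>" unfolding q_eq using rho_ge_1[OF T_simplex] q_simplex by (simp add: q_eq)
lemma log_rate_nonneg: "0 \<le> log_rate" unfolding log_rate_def by (intro divide_nonneg_nonneg ln_ge_zero) (simp_all add: Suc_leI)
lemma err_nonneg: "0 \<le> err" and col_err_nonneg: "0 \<le> col_err"
  by (simp_all add: err_def col_err_def l1norm_nonneg max_col_l1norm_nonneg)
lemma in_J_pos_iff: "j \<in> J_pos \<longleftrightarrow> 0 < q $ j" by (simp add: J_over_def)
lemma q_zero: "j \<notin> J_pos \<Longrightarrow> q $ j = 0" using q_nonneg[of j] by (simp add: in_J_pos_iff)
lemma x_zero: "\<not> 0 < x $ j \<Longrightarrow> x $ j = 0" using x_nonneg[of j] by simp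
lemma small_row_err_nonneg: "0 \<le> small_row_err" unfolding small_row_err_def
  by (intro sum_nonneg mult_nonneg_nonneg divide_nonneg_nonneg infnorm_pos_le log_rate_nonneg q_nonneg)

lemma J_large_subset_J_pos: "J_large \<subseteq> J_pos"
proof
  fix j assume "j \<in> J_large"
  then show "j \<in> J_pos"
    using eps_nonneg[where q = q and j = j and N = N, OF q_nonneg] by (simp add: J_under_def in_J_pos_iff)
qed

lemma x_large: "j \<in> J_large \<Longrightarrow> q $ j / 2 \<le> x $ j"
  using x_lower[of j] by (simp add: J_under_def)

lemma x_le: "x $ j \<le> (2 + (if j \<in> J_large then 0 else 7 / 3 * log_rate / q $ j)) * q $ j" if "j \<in> J_pos" for j
proof (cases "j \<in> J_large")
  case True
  then show ?thesis using x_upper[of j] q_nonneg[of j] by (simp add: J_under_def)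
next
  case False
  then show ?thesis using that x_upper[of j] eps_le[OF q_nonneg[of j], of N]
    by (simp add: in_J_pos_iff distrib_right log_rate_def)
qed

lemma sum_row_error_le: "(\<Sum>j\<in>J_pos. \<bar>(B $ j - A $ j) \<bullet> v\<bar>) \<le> col_err * l1norm v"
  using l1norm_mult_le_max_col_l1norm[of "restrict_rows J_pos (B - A)" v]
  by (simp add: col_err_def restrict_rows_diff l1norm_restrict_rows_mult)

lemma row_error_le: "\<bar>(B $ j - A $ j) \<bullet> T\<bar> \<le> infnorm (B $ j - A $ j)"
  using abs_inner_le_infnorm_l1norm[of "B $ j - A $ j" T] by (simp add: l1norm_simplex[OF T_simplex])

lemma B_T_bounds: "j \<in> J_pos \<Longrightarrow> q $ j / 2 \<le> B $ j \<bullet> T"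
  using row_error_le[of j] row_error[of j] by (simp add: inner_diff_left q_component)

lemma B_T_pos: "j \<in> J_pos \<Longrightarrow> 0 < B $ j \<bullet> T"
  using B_T_bounds[of j] by (simp add: in_J_pos_iff)

lemma x_pos_J_pos: "0 < x $ j \<Longrightarrow> j \<in> J_pos" using x_support[of j] by auto

lemma A_diff_le: "\<bar>A $ j \<bullet> (T_hat - T)\<bar> \<le> \<rho> * q $ j * err" if "j \<in> J_pos"
proof -
  have "\<bar>A $ j \<bullet> (T_hat - T)\<bar> \<le> infnorm (A $ j) * err"
    unfolding err_def by (rule abs_inner_le_infnorm_l1norm)
  also have "\<dots> \<le> \<rho> * q $ j * err"
    using that by (intro mult_right_mono infnorm_row_le_rho err_nonneg) (simp add: in_J_pos_iff)
  finally show ?thesis .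
qed

text \<open>
  The effect on cell \<open>j\<close> of replacing \<open>B $ j / (B $ j \<bullet> T)\<close> by \<open>A $ j / q $ j\<close>, up to the factor \<open>2 / q $ j\<close>: the
  first summand is due to the numerator, the second to the denominator. It is kept in terms of
  \<open>B $ j - A $ j\<close> applied to \<open>T_hat - T\<close> and \<open>T\<close>, because its sum over \<open>j\<close> is then controlled by the
  column norms of \<open>B - A\<close> and not only by the larger sum of the row maxima.
\<close>
definition "row_perturbation j = \<bar>(B $ j - A $ j) \<bullet> (T_hat - T)\<bar> + \<rho> * err * \<bar>(B $ j - A $ j) \<bullet> T\<bar>"

lemma row_perturbation_nonneg: "0 \<le> row_perturbation j"
  unfolding row_perturbation_def using \<rho>_ge_1 err_nonneg by simp

lemma score_term_le:
  assumes j: "j \<in> J_pos"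
  shows "(B $ j \<bullet> (T_hat - T)) / (B $ j \<bullet> T) \<le> (A $ j \<bullet> (T_hat - T)) / q $ j + 2 / q $ j * row_perturbation j"
proof -
  define \<beta> where "\<beta> = B $ j \<bullet> T"
  define a where "a = A $ j \<bullet> (T_hat - T)"
  define u where "u = (B $ j - A $ j) \<bullet> (T_hat - T)"
  define w where "w = (B $ j - A $ j) \<bullet> T"
  have qj: "0 < q $ j" using j by (simp add: in_J_pos_iff)
  have \<beta>: "0 < \<beta>" "q $ j / 2 \<le> \<beta>" unfolding \<beta>_def using B_T_pos[OF j] B_T_bounds[OF j] .
  have inv: "1 / \<beta> \<le> 2 / q $ j" using \<beta> qj by (simp add: field_simps)
  have w_eq: "\<beta> = q $ j + w" by (simp add: \<beta>_def w_def q_component inner_diff_left)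
  have "B $ j \<bullet> (T_hat - T) = a + u" by (simp add: a_def u_def inner_diff_left)
  then have "(B $ j \<bullet> (T_hat - T)) / (B $ j \<bullet> T) = (a + u) / \<beta>" by (simp add: \<beta>_def)
  also have "\<dots> = a / q $ j + 1 / \<beta> * (u - a / q $ j * w)"
  proof -
    have w': "w = \<beta> - q $ j" using w_eq by simp
    show ?thesis unfolding w' using \<beta>(1) qj by (simp add: field_simps)
  qed
  also have "\<dots> \<le> a / q $ j + 1 / \<beta> * row_perturbation j"
  proof -
    have "\<bar>a / q $ j\<bar> \<le> \<rho> * err"
      using A_diff_le[OF j] qj by (simp add: a_def abs_divide pos_divide_le_eq mult_ac)
    then have "\<bar>a / q $ j * w\<bar> \<le> \<rho> * err * \<bar>w\<bar>" unfolding abs_mult by (intro mult_right_mono) auto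
    then have "u - a / q $ j * w \<le> row_perturbation j"
      unfolding row_perturbation_def u_def[symmetric] w_def[symmetric] by linarith
    then show ?thesis using \<beta> by (intro add_left_mono mult_left_mono) auto
  qed
  also have "\<dots> \<le> a / q $ j + 2 / q $ j * row_perturbation j"
    using inv by (intro add_left_mono mult_right_mono row_perturbation_nonneg)
  finally show ?thesis by (simp add: a_def)
qed

text \<open>
  Write \<open>x = (x - q) + q\<close>. The part with \<open>q\<close> sums to the mass of \<open>A *v T_hat\<close> on \<open>J_pos\<close> minus the mass
  of \<open>q\<close>, that is, to at most \<open>1 - 1\<close>. The part with \<open>x - q\<close> is the pairing of \<open>T_hat - T\<close> with the
  vector of weighted sums bounded in \<open>noise\<close>.
\<close>
lemma noise_le: "(\<Sum>j\<in>J_pos. x $ j * ((A $ j \<bullet> (T_hat - T)) / q $ j)) \<le> noise_level * err"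
proof -
  have "(\<Sum>j\<in>J_pos. x $ j * ((A $ j \<bullet> (T_hat - T)) / q $ j))
      = (\<Sum>j\<in>J_pos. (x $ j - q $ j) * ((A $ j \<bullet> (T_hat - T)) / q $ j)) + (\<Sum>j\<in>J_pos. A $ j \<bullet> (T_hat - T))"
    unfolding sum.distrib[symmetric] by (intro sum.cong) (auto simp: in_J_pos_iff field_simps)
  moreover have "(\<Sum>j\<in>J_pos. A $ j \<bullet> (T_hat - T)) \<le> 0"
  proof -
    have "(\<Sum>j\<in>J_pos. A $ j \<bullet> T_hat) = (\<Sum>j\<in>J_pos. (A *v T_hat) $ j)"
      by (simp add: matrix_vector_mul_component)
    also have "\<dots> \<le> (\<Sum>j\<in>UNIV. (A *v T_hat) $ j)"
      using matrix_mult_simplex[OF A_cols T_hat_simplex] by (intro sum_mono2) (auto simp: prob_simplex_def)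
    also have "\<dots> = (\<Sum>j\<in>UNIV. q $ j)"
      using matrix_mult_simplex[OF A_cols T_hat_simplex] q_simplex by (simp add: prob_simplex_def)
    also have "\<dots> = (\<Sum>j\<in>J_pos. q $ j)"
      by (intro sum.mono_neutral_right) (auto simp: q_zero)
    finally show ?thesis by (simp add: inner_diff_right sum_subtractf q_component)
  qed
  moreover have "(\<Sum>j\<in>J_pos. (x $ j - q $ j) * ((A $ j \<bullet> (T_hat - T)) / q $ j)) \<le> noise_level * err"
  proof -
    define Z where "Z k = (\<Sum>j\<in>UNIV. (x $ j - q $ j) * (A $ j $ k / q $ j))" for k
    have Z_le: "(T_hat - T) $ k * Z k \<le> noise_level * \<bar>(T_hat - T) $ k\<bar>" for k
    proof -
      have "(T_hat - T) $ k * Z k \<le> \<bar>(T_hat - T) $ k\<bar> * \<bar>Z k\<bar>"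
        unfolding abs_mult[symmetric] by (rule abs_ge_self)
      also have "\<dots> \<le> \<bar>(T_hat - T) $ k\<bar> * noise_level"
        using noise[of k] by (intro mult_left_mono) (simp_all add: Z_def noise_level_def log_rate_def)
      finally show ?thesis by (simp only: mult.commute)
    qed
    have "(\<Sum>j\<in>J_pos. (x $ j - q $ j) * ((A $ j \<bullet> (T_hat - T)) / q $ j))
        = (\<Sum>j\<in>UNIV. (x $ j - q $ j) * ((A $ j \<bullet> (T_hat - T)) / q $ j))"
      by (intro sum.mono_neutral_left) (auto simp: q_zero)
    moreover have "\<dots> = (\<Sum>k\<in>UNIV. (T_hat - T) $ k * Z k)"
      unfolding inner_vec_def sum_divide_distrib sum_distrib_left Z_def
      by (subst sum.swap) (simp add: mult_ac)
    moreover have "(\<Sum>k\<in>UNIV. (T_hat - T) $ k * Z k) \<le> noise_level * err"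
      unfolding err_def l1norm_def sum_distrib_left by (intro sum_mono Z_le)
    ultimately show ?thesis by linarith
  qed
  ultimately show ?thesis by linarith
qed

text \<open>
  By \<open>x_le\<close> the frequency \<open>x $ j\<close> is at most \<open>2 * q $ j\<close>, up to the excess \<open>7 / 3 * log_rate\<close> off \<open>J_large\<close>. The
  first part sums to the column error, the excess to the weighted row errors \<open>small_row_err\<close>.
\<close>
lemma perturbation_le:
  "(\<Sum>j\<in>J_pos. x $ j * (2 / q $ j * row_perturbation j)) \<le> (8 * \<rho> * col_err + 28 / 3 * \<rho> * small_row_err) * err"
proof -
  have "(\<Sum>j\<in>J_pos. x $ j * (2 / q $ j * row_perturbation j))
      \<le> (\<Sum>j\<in>J_pos. 4 * row_perturbation j + (if j \<in> J_large then 0 else 14 / 3 * (log_rate / q $ j) * row_perturbation j))"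
  proof (rule sum_mono)
    fix j assume j: "j \<in> J_pos"
    then have "x $ j / q $ j \<le> 2 + (if j \<in> J_large then 0 else 7 / 3 * log_rate / q $ j)"
      using x_le[OF j] by (simp only: in_J_pos_iff pos_divide_le_eq)
    then have "x $ j / q $ j * (2 * row_perturbation j)
        \<le> (2 + (if j \<in> J_large then 0 else 7 / 3 * log_rate / q $ j)) * (2 * row_perturbation j)"
      by (rule mult_right_mono) (simp add: row_perturbation_nonneg)
    then show "x $ j * (2 / q $ j * row_perturbation j)
        \<le> 4 * row_perturbation j + (if j \<in> J_large then 0 else 14 / 3 * (log_rate / q $ j) * row_perturbation j)"
      by (simp add: algebra_simps split: if_splits)
  qed
  also have "\<dots> = 4 * (\<Sum>j\<in>J_pos. row_perturbation j) + (\<Sum>j\<in>J_pos - J_large. 14 / 3 * (log_rate / q $ j) * row_perturbation j)"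
    by (simp add: sum.distrib sum_distrib_left sum.If_cases Diff_eq)
  also have "(\<Sum>j\<in>J_pos. row_perturbation j) \<le> 2 * \<rho> * col_err * err"
  proof -
    have "(\<Sum>j\<in>J_pos. row_perturbation j) \<le> col_err * err + \<rho> * err * (col_err * 1)"
      using sum_row_error_le[of "T_hat - T"] sum_row_error_le[of T] \<rho>_ge_1 err_nonneg
      unfolding row_perturbation_def sum.distrib sum_distrib_left[symmetric]
      by (intro add_mono mult_left_mono) (auto simp: err_def l1norm_simplex[OF T_simplex])
    also have "col_err * err \<le> \<rho> * (col_err * err)"
      using \<rho>_ge_1 err_nonneg col_err_nonneg mult_right_mono[of 1 \<rho> "col_err * err"] by simp
    finally show ?thesis by (simp add: mult_ac)
  qed
  also have "(\<Sum>j\<in>J_pos - J_large. 14 / 3 * (log_rate / q $ j) * row_perturbation j)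
      \<le> (\<Sum>j\<in>J_pos - J_large. 28 / 3 * \<rho> * err * (infnorm (B $ j - A $ j) / q $ j * log_rate))"
  proof (rule sum_mono)
    fix j
    let ?i = "infnorm (B $ j - A $ j)"
    have i: "0 \<le> ?i" by (rule infnorm_pos_le)
    have "row_perturbation j \<le> ?i * err + \<rho> * err * ?i"
      unfolding row_perturbation_def
      using abs_inner_le_infnorm_l1norm[of "B $ j - A $ j" "T_hat - T"] row_error_le[of j] \<rho>_ge_1 err_nonneg
      by (intro add_mono mult_left_mono) (auto simp: err_def)
    also have "?i * err \<le> \<rho> * (?i * err)"
      using \<rho>_ge_1 err_nonneg i mult_right_mono[of 1 \<rho> "?i * err"] by simp
    finally have "row_perturbation j \<le> 2 * \<rho> * err * ?i" by (simp add: mult_ac)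
    then have "14 / 3 * (log_rate / q $ j) * row_perturbation j \<le> 14 / 3 * (log_rate / q $ j) * (2 * \<rho> * err * ?i)"
      using log_rate_nonneg q_nonneg[of j] by (intro mult_left_mono) auto
    then show "14 / 3 * (log_rate / q $ j) * row_perturbation j \<le> 28 / 3 * \<rho> * err * (?i / q $ j * log_rate)"
      by (simp add: mult_ac)
  qed
  also have "\<dots> = 28 / 3 * \<rho> * err * small_row_err" by (simp add: small_row_err_def sum_distrib_left)
  finally show ?thesis by (simp add: algebra_simps)
qed

lemma score_le: "(\<Sum>j\<in>J_pos. x $ j * (B $ j \<bullet> (T_hat - T)) / (B $ j \<bullet> T)) \<le> score_bound * err"
proof -
  have "(\<Sum>j\<in>J_pos. x $ j * (B $ j \<bullet> (T_hat - T)) / (B $ j \<bullet> T))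
      \<le> (\<Sum>j\<in>J_pos. x $ j * ((A $ j \<bullet> (T_hat - T)) / q $ j) + x $ j * (2 / q $ j * row_perturbation j))"
  proof (rule sum_mono)
    fix j assume "j \<in> J_pos"
    from mult_left_mono[OF score_term_le[OF this] x_nonneg]
    show "x $ j * (B $ j \<bullet> (T_hat - T)) / (B $ j \<bullet> T)
        \<le> x $ j * ((A $ j \<bullet> (T_hat - T)) / q $ j) + x $ j * (2 / q $ j * row_perturbation j)"
      by (simp only: distrib_left times_divide_eq_right)
  qed
  also have "\<dots> \<le> score_bound * err"
    using noise_le perturbation_le unfolding sum.distrib score_bound_def distrib_right by linarith
  finally show ?thesis .
qed

definition "curvature = (\<Sum>j | 0 < x $ j. x $ j * (B $ j \<bullet> (T_hat - T))\<^sup>2 / ((B $ j \<bullet> T) * (B $ j \<bullet> T_hat)))"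

lemma B_T_pos_if_x_pos: "0 < x $ j \<Longrightarrow> 0 < B $ j \<bullet> T"
  by (rule B_T_pos[OF x_pos_J_pos])

lemma B_T_hat_pos: "0 < x $ j \<Longrightarrow> 0 < B $ j \<bullet> T_hat"
  using plugin_mle_first_order(1)[OF maximizer N_pos T_simplex B_T_pos_if_x_pos] by simp

text \<open>
  With \<open>\<beta>\<close> and \<open>\<eta>\<close> for the fitted probabilities at \<open>T\<close> and \<open>T_hat\<close>, the identity
  \<open>(\<eta> - \<beta>)\<^sup>2 / (\<beta> \<eta>) = (\<eta> - \<beta>) / \<beta> - (\<eta> - \<beta>) / \<eta>\<close> writes the curvature as the score at \<open>T\<close> minus that
  at \<open>T_hat\<close>, and the latter is nonnegative by optimality.
\<close>
lemma curvature_le: "curvature \<le> score_bound * err"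
proof -
  have "curvature = (\<Sum>j | 0 < x $ j. x $ j * (B $ j \<bullet> (T_hat - T)) / (B $ j \<bullet> T)
      + x $ j * (B $ j \<bullet> (T - T_hat)) / (B $ j \<bullet> T_hat))"
    unfolding curvature_def
  proof (intro sum.cong refl)
    fix j assume "j \<in> {j. 0 < x $ j}"
    then have "0 < B $ j \<bullet> T" "0 < B $ j \<bullet> T_hat" using B_T_pos x_pos_J_pos B_T_hat_pos by auto
    then show "x $ j * (B $ j \<bullet> (T_hat - T))\<^sup>2 / ((B $ j \<bullet> T) * (B $ j \<bullet> T_hat))
      = x $ j * (B $ j \<bullet> (T_hat - T)) / (B $ j \<bullet> T) + x $ j * (B $ j \<bullet> (T - T_hat)) / (B $ j \<bullet> T_hat)"
      by (simp add: inner_diff_right field_simps power2_eq_square)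
  qed
  also have "\<dots> = (\<Sum>j | 0 < x $ j. x $ j * (B $ j \<bullet> (T_hat - T)) / (B $ j \<bullet> T))
      + (\<Sum>j | 0 < x $ j. x $ j * (B $ j \<bullet> (T - T_hat)) / (B $ j \<bullet> T_hat))"
    by (rule sum.distrib)
  also have "\<dots> \<le> (\<Sum>j | 0 < x $ j. x $ j * (B $ j \<bullet> (T_hat - T)) / (B $ j \<bullet> T))"
    using plugin_mle_first_order(2)[OF maximizer N_pos T_simplex B_T_pos_if_x_pos] by simp
  also have "\<dots> = (\<Sum>j\<in>J_pos. x $ j * (B $ j \<bullet> (T_hat - T)) / (B $ j \<bullet> T))"
    by (intro sum.mono_neutral_left) (auto simp: x_pos_J_pos x_zero)
  finally show ?thesis using score_le by linarith
qed

text \<open>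
  On \<open>J_large\<close> the weight is at most \<open>2 (B $ j \<bullet> T) (B $ j \<bullet> T_hat) / q $ j\<close>. With \<open>q $ j\<close> in place of
  \<open>B $ j \<bullet> T\<close> this would sum to at most 2. Bounding \<open>B $ j \<bullet> T\<close> by \<open>3 / 2 * q $ j\<close> would give 3, too much
  for the constant of the theorem; the error is instead charged to \<open>col_err\<close>.
\<close>
lemma weights_le: "(\<Sum>j\<in>J_large. (B $ j \<bullet> T) * (B $ j \<bullet> T_hat) / x $ j) \<le> 2 + 3 * \<rho> * col_err"
proof -
  have "(\<Sum>j\<in>J_large. (B $ j \<bullet> T) * (B $ j \<bullet> T_hat) / x $ j)
      \<le> (\<Sum>j\<in>J_large. 2 * (B *v T_hat) $ j + 3 * \<rho> * \<bar>(B $ j - A $ j) \<bullet> T\<bar>)"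
  proof (rule sum_mono)
    fix j assume U: "j \<in> J_large"
    then have j: "j \<in> J_pos" using J_large_subset_J_pos by blast
    then have qj: "0 < q $ j" by (simp add: in_J_pos_iff)
    define w where "w = (B $ j - A $ j) \<bullet> T"
    define \<eta> where "\<eta> = B $ j \<bullet> T_hat"
    have x: "q $ j / 2 \<le> x $ j" using x_large[OF U] .
    have "0 < x $ j" using qj x_large[OF U] by linarith
    then have \<eta>: "0 < \<eta>" unfolding \<eta>_def by (rule B_T_hat_pos)
    have BT: "B $ j \<bullet> T = q $ j + w" by (simp add: w_def q_component inner_diff_left)
    have "\<eta> \<le> \<bar>A $ j \<bullet> T_hat\<bar> + \<bar>(B $ j - A $ j) \<bullet> T_hat\<bar>"
      by (simp add: \<eta>_def inner_diff_left)
    also have "\<dots> \<le> infnorm (A $ j) + infnorm (B $ j - A $ j)"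
      using abs_inner_le_infnorm_l1norm[of _ T_hat] by (intro add_mono) (simp_all add: l1norm_simplex[OF T_hat_simplex])
    also have "\<dots> \<le> \<rho> * q $ j + q $ j / 2"
      using infnorm_row_le_rho[of q j A] row_error[OF j] qj by linarith
    also have "q $ j / 2 \<le> \<rho> * q $ j / 2" using \<rho>_ge_1 qj by simp
    finally have \<eta>_le: "\<eta> \<le> 3 / 2 * \<rho> * q $ j" by simp
    have "(B $ j \<bullet> T) * \<eta> / x $ j \<le> (B $ j \<bullet> T) * \<eta> / (q $ j / 2)"
      using x qj \<eta> B_T_pos[OF j] by (intro divide_left_mono) auto
    also have "\<dots> = 2 * \<eta> + 2 * w * (\<eta> / q $ j)"
      using qj by (simp add: BT field_simps)
    also have "2 * w * (\<eta> / q $ j) \<le> 2 * \<bar>w\<bar> * (3 / 2 * \<rho>)"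
    proof -
      have "2 * w * (\<eta> / q $ j) \<le> 2 * \<bar>w\<bar> * (\<eta> / q $ j)"
        using \<eta> qj by (intro mult_right_mono) auto
      also have "\<dots> \<le> 2 * \<bar>w\<bar> * (3 / 2 * \<rho>)"
        using \<eta>_le qj by (intro mult_left_mono) (simp_all add: pos_divide_le_eq)
      finally show ?thesis .
    qed
    finally show "(B $ j \<bullet> T) * (B $ j \<bullet> T_hat) / x $ j
        \<le> 2 * (B *v T_hat) $ j + 3 * \<rho> * \<bar>(B $ j - A $ j) \<bullet> T\<bar>"
      by (simp add: \<eta>_def w_def matrix_vector_mul_component)
  qed
  also have "\<dots> = 2 * (\<Sum>j\<in>J_large. (B *v T_hat) $ j) + 3 * \<rho> * (\<Sum>j\<in>J_large. \<bar>(B $ j - A $ j) \<bullet> T\<bar>)"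
    by (simp add: sum.distrib sum_distrib_left)
  also have "\<dots> \<le> 2 * 1 + 3 * \<rho> * col_err"
  proof (intro add_mono mult_left_mono)
    show "(\<Sum>j\<in>J_large. (B *v T_hat) $ j) \<le> 1"
      using matrix_mult_simplex[OF B_cols T_hat_simplex] sum_mono2[of UNIV J_large "\<lambda>j. (B *v T_hat) $ j"]
      by (simp add: prob_simplex_def)
    have "(\<Sum>j\<in>J_large. \<bar>(B $ j - A $ j) \<bullet> T\<bar>) \<le> (\<Sum>j\<in>J_pos. \<bar>(B $ j - A $ j) \<bullet> T\<bar>)"
      using J_large_subset_J_pos by (intro sum_mono2) auto
    then show "(\<Sum>j\<in>J_large. \<bar>(B $ j - A $ j) \<bullet> T\<bar>) \<le> col_err"
      using sum_row_error_le[of T] by (simp add: l1norm_simplex[OF T_simplex])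
  qed (use \<rho>_ge_1 in auto)
  finally show ?thesis by simp
qed

text \<open>
  Cauchy-Schwarz, with the weights chosen such that the first factor is part of the curvature.
\<close>
lemma plugin_prediction_error:
  "(\<Sum>j\<in>J_large. \<bar>B $ j \<bullet> (T_hat - T)\<bar>)\<^sup>2 \<le> score_bound * err * (2 + 3 * \<rho> * col_err)"
proof -
  have x_pos: "0 < x $ j" if "j \<in> J_large" for j
  proof -
    have "0 < q $ j" using that J_large_subset_J_pos by (auto simp: in_J_pos_iff[symmetric])
    then show ?thesis using x_large[OF that] by linarith
  qed
  have pos: "0 < (B $ j \<bullet> T) * (B $ j \<bullet> T_hat)" if "j \<in> J_large" for j
    using x_pos[OF that] that J_large_subset_J_pos by (intro mult_pos_pos B_T_pos B_T_hat_pos) auto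
  let ?w = "\<lambda>j. (B $ j \<bullet> T) * (B $ j \<bullet> T_hat) / x $ j"
  have w: "0 < ?w j" if "j \<in> J_large" for j using x_pos[OF that] pos[OF that] by (rule divide_pos_pos[rotated])
  have "(\<Sum>j\<in>J_large. \<bar>B $ j \<bullet> (T_hat - T)\<bar>) = (\<Sum>j\<in>J_large. \<bar>B $ j \<bullet> (T_hat - T)\<bar> / sqrt (?w j) * sqrt (?w j))"
  proof (intro sum.cong refl)
    have cancel: "a = a / c * c" if "0 < c" for a c :: real using that by simp
    show "\<bar>B $ j \<bullet> (T_hat - T)\<bar> = \<bar>B $ j \<bullet> (T_hat - T)\<bar> / sqrt (?w j) * sqrt (?w j)" if "j \<in> J_large" for j
      by (rule cancel[OF real_sqrt_gt_zero[OF w[OF that]]])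
  qed
  then have "(\<Sum>j\<in>J_large. \<bar>B $ j \<bullet> (T_hat - T)\<bar>)\<^sup>2
      \<le> (\<Sum>j\<in>J_large. (\<bar>B $ j \<bullet> (T_hat - T)\<bar> / sqrt (?w j))\<^sup>2) * (\<Sum>j\<in>J_large. (sqrt (?w j))\<^sup>2)"
    by (simp only: Cauchy_Schwarz_ineq_sum)
  also have "(\<Sum>j\<in>J_large. (sqrt (?w j))\<^sup>2) = (\<Sum>j\<in>J_large. ?w j)"
    using w by (intro sum.cong) (auto simp: less_imp_le)
  also have "(\<Sum>j\<in>J_large. (\<bar>B $ j \<bullet> (T_hat - T)\<bar> / sqrt (?w j))\<^sup>2)
      = (\<Sum>j\<in>J_large. x $ j * (B $ j \<bullet> (T_hat - T))\<^sup>2 / ((B $ j \<bullet> T) * (B $ j \<bullet> T_hat)))"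
  proof (intro sum.cong refl)
    fix j assume "j \<in> J_large"
    then have "(sqrt (?w j))\<^sup>2 = ?w j" using w by (simp add: less_imp_le)
    then show "(\<bar>B $ j \<bullet> (T_hat - T)\<bar> / sqrt (?w j))\<^sup>2
        = x $ j * (B $ j \<bullet> (T_hat - T))\<^sup>2 / ((B $ j \<bullet> T) * (B $ j \<bullet> T_hat))"
      unfolding power_divide power2_abs by (simp add: mult_ac)
  qed
  also have "\<dots> \<le> curvature"
    unfolding curvature_def using x_pos B_T_pos B_T_hat_pos x_pos_J_pos
    by (intro sum_mono2) (auto simp: less_imp_le)
  also have "curvature * (\<Sum>j\<in>J_large. ?w j) \<le> score_bound * err * (2 + 3 * \<rho> * col_err)"
  proof (intro mult_mono curvature_le weights_le)
    have "0 \<le> curvature" unfolding curvature_def using B_T_pos B_T_hat_pos x_pos_J_pos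
      by (intro sum_nonneg) (auto simp: less_imp_le)
    then show "0 \<le> score_bound * err" using curvature_le by linarith
    show "0 \<le> (\<Sum>j\<in>J_large. ?w j)" using w by (intro sum_nonneg) (simp add: less_imp_le)
  qed
  finally show ?thesis
    by (simp add: mult_right_mono sum_nonneg w less_imp_le)
qed

lemma kappa_err_le: "kappa (restrict_rows J_large A) s * err \<le> (\<Sum>j\<in>J_large. \<bar>B $ j \<bullet> (T_hat - T)\<bar>) + col_err * err"
proof (cases "T_hat = T")
  case True
  then have "err = 0" unfolding err_def l1norm_def by simp
  then show ?thesis by (simp add: sum_nonneg)
next
  case False
  then have "kappa (restrict_rows J_large A) s * err \<le> (\<Sum>j\<in>J_large. \<bar>A $ j \<bullet> (T_hat - T)\<bar>)"
    unfolding err_def l1norm_restrict_rows_mult[symmetric] using T_sparse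
    by (intro kappa_mult_l1norm_le[OF _ simplex_diff_in_dominant_cone[OF T_simplex T_hat_simplex]])
      (auto simp: sparse_simplex_def)
  also have "\<dots> \<le> (\<Sum>j\<in>J_large. \<bar>B $ j \<bullet> (T_hat - T)\<bar> + \<bar>(B $ j - A $ j) \<bullet> (T_hat - T)\<bar>)"
    by (intro sum_mono) (simp add: inner_diff_left)
  also have "\<dots> = (\<Sum>j\<in>J_large. \<bar>B $ j \<bullet> (T_hat - T)\<bar>) + (\<Sum>j\<in>J_large. \<bar>(B $ j - A $ j) \<bullet> (T_hat - T)\<bar>)"
    by (rule sum.distrib)
  also have "(\<Sum>j\<in>J_large. \<bar>(B $ j - A $ j) \<bullet> (T_hat - T)\<bar>) \<le> (\<Sum>j\<in>J_pos. \<bar>(B $ j - A $ j) \<bullet> (T_hat - T)\<bar>)"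
    using J_large_subset_J_pos by (intro sum_mono2) auto
  also have "\<dots> \<le> col_err * err" unfolding err_def by (rule sum_row_error_le)
  finally show ?thesis by simp
qed

text \<open>
  If the bound fails, then its right-hand side is less than 2, so that \<open>24 \<rho> col_err < \<kappa>\<^sup>2\<close> and
  \<open>score_bound \<le> 1\<close>. The losses \<open>2 * \<kappa> * col_err * err\<close> from replacing \<open>\<kappa>\<close> by \<open>\<kappa> - col_err\<close> and
  \<open>3 * \<rho> * col_err * score_bound\<close> from the weights are then at most \<open>7 * \<rho> * col_err\<close>. Together with
  the \<open>16 * \<rho> * col_err\<close> contained in \<open>2 * score_bound\<close> this stays below the available
  \<open>48 * \<rho> * col_err\<close>. In the noise term, the factor 2 of the Cauchy-Schwarz step meets
  \<open>2 * sqrt 4 \<le> 3 * sqrt 2\<close>.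
\<close>
lemma plugin_error_le:
  assumes \<kappa>: "kappa (restrict_rows J_large A) s \<noteq> 0"
  shows "err \<le> 3 / (kappa (restrict_rows J_large A) s)\<^sup>2 *
    (sqrt (2 * \<rho> * log_rate) + 2 / 3 * \<rho> * log_rate + 16 * \<rho> * col_err + 56 / 3 * \<rho> * small_row_err)"
proof (rule ccontr)
  define \<kappa> where "\<kappa> = kappa (restrict_rows J_large A) s"
  define R where "R = sqrt (2 * \<rho> * log_rate) + 2 / 3 * \<rho> * log_rate + 16 * \<rho> * col_err + 56 / 3 * \<rho> * small_row_err"
  have k: "0 < \<kappa>" "\<kappa> \<le> 1"
    using \<kappa> kappa_nonneg[OF s_pos, of "restrict_rows J_large A"] kappa_le_1[OF A_cols s_pos]
    unfolding \<kappa>_def by auto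
  have parts: "0 \<le> sqrt (2 * \<rho> * log_rate)" "0 \<le> \<rho> * log_rate" "col_err \<le> \<rho> * col_err" "0 \<le> col_err" "0 \<le> \<rho> * small_row_err"
    using \<rho>_ge_1 log_rate_nonneg col_err_nonneg small_row_err_nonneg mult_right_mono[of 1 \<rho> col_err] by auto
  assume "\<not> ?thesis"
  then have "3 / \<kappa>\<^sup>2 * R < err" by (simp add: \<kappa>_def R_def)
  then have R: "3 * R < \<kappa>\<^sup>2 * err" using k by (simp add: field_simps)
  have err_le_2: "err \<le> 2" unfolding err_def by (rule l1norm_diff_simplex_le_2[OF T_hat_simplex T_simplex])
  have "0 \<le> R" unfolding R_def using parts by simp
  then have "0 < \<kappa>\<^sup>2 * err" using R by linarith
  then have err: "0 < err" using k by (simp add: zero_less_mult_iff)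
  have "\<kappa>\<^sup>2 * err \<le> \<kappa>\<^sup>2 * 2" using err_le_2 by (intro mult_left_mono) auto
  moreover have "\<kappa>\<^sup>2 \<le> \<kappa>" using k by (simp add: power2_eq_square mult_left_le)
  ultimately have R_lt: "3 * R < 2 * \<kappa>" using R by linarith
  have col_err_le: "16 * (\<rho> * col_err) \<le> R" unfolding R_def using parts by simp
  then have col_err_le_\<kappa>: "col_err \<le> \<kappa>" using R_lt parts k by linarith
  have noise_le: "noise_level \<le> 3 / 2 * (sqrt (2 * \<rho> * log_rate) + 2 / 3 * \<rho> * log_rate)"
  proof -
    have "sqrt (4 * \<rho> * log_rate) \<le> sqrt ((3 / 2)\<^sup>2 * (2 * \<rho> * log_rate))"
      using parts by (simp add: power2_eq_square)
    also have "\<dots> = 3 / 2 * sqrt (2 * \<rho> * log_rate)" by (simp only: real_sqrt_mult) simp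
    finally show ?thesis unfolding noise_level_def using parts by simp
  qed
  then have G: "2 * score_bound + 7 * (\<rho> * col_err) \<le> 3 * R" "score_bound \<le> 1"
    using parts R_lt k unfolding score_bound_def R_def by simp_all
  have "(\<kappa> - col_err) * err \<le> (\<Sum>j\<in>J_large. \<bar>B $ j \<bullet> (T_hat - T)\<bar>)"
    using kappa_err_le by (simp add: \<kappa>_def algebra_simps)
  then have "((\<kappa> - col_err) * err)\<^sup>2 \<le> (\<Sum>j\<in>J_large. \<bar>B $ j \<bullet> (T_hat - T)\<bar>)\<^sup>2"
    using col_err_le_\<kappa> err by (intro power_mono) auto
  also have "\<dots> \<le> score_bound * err * (2 + 3 * \<rho> * col_err)" by (rule plugin_prediction_error)
  finally have "err * ((\<kappa> - col_err)\<^sup>2 * err) \<le> err * (score_bound * (2 + 3 * \<rho> * col_err))"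
    by (simp add: power2_eq_square mult_ac)
  then have main: "(\<kappa> - col_err)\<^sup>2 * err \<le> score_bound * (2 + 3 * \<rho> * col_err)" using err by simp
  have "(\<kappa>\<^sup>2 - 2 * col_err) * err \<le> (\<kappa> - col_err)\<^sup>2 * err"
  proof (intro mult_right_mono)
    have "\<kappa> * col_err \<le> 1 * col_err" using k parts by (intro mult_right_mono) auto
    moreover have "(\<kappa> - col_err)\<^sup>2 = \<kappa>\<^sup>2 - 2 * (\<kappa> * col_err) + col_err\<^sup>2" by (simp add: power2_diff)
    ultimately show "\<kappa>\<^sup>2 - 2 * col_err \<le> (\<kappa> - col_err)\<^sup>2" using zero_le_power2[of col_err] by linarith
  qed (use err in simp)
  moreover have "2 * col_err * err \<le> 2 * col_err * 2" using err_le_2 parts by (intro mult_left_mono) auto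
  moreover have "score_bound * (3 * \<rho> * col_err) \<le> 1 * (3 * \<rho> * col_err)"
    using G parts by (intro mult_right_mono) auto
  ultimately have "\<kappa>\<^sup>2 * err \<le> 2 * score_bound + 4 * col_err + 3 * (\<rho> * col_err)"
    using main by (simp add: algebra_simps)
  then show False using R G parts by linarith
qed

end

section \<open>Invariance under relabelling of the columns\<close>

lemma permutation_matrixE:
  assumes "permutation_matrix P"
  obtains \<pi> where "bij \<pi>" "P = (\<chi> i j. if j = \<pi> i then 1 else 0)"
  using assms by (auto simp: permutation_matrix_def)

lemma transpose_permutation_matrix:
  assumes "bij \<pi>"
  shows "transpose (\<chi> i j. if j = \<pi> i then 1 else 0) = (\<chi> i j. if j = inv \<pi> i then 1 else (0 :: real))"
  using assms by (auto simp: transpose_def vec_eq_iff bij_inv_eq_iff)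

lemma permutation_matrix_transpose: "permutation_matrix P \<Longrightarrow> permutation_matrix (transpose P)"
  by (metis bij_imp_bij_inv permutation_matrix_def transpose_permutation_matrix)

lemma permutation_matrix_mult_component:
  "(((\<chi> i j. if j = \<pi> i then 1 else 0) :: real ^ 'n ^ 'n) *v v) $ i = v $ \<pi> i"
  by (simp add: matrix_vector_mult_def if_distrib[of "\<lambda>c. c * _"] cong: if_cong)

lemma mult_permutation_matrix_component:
  assumes "bij \<pi>"
  shows "(A ** ((\<chi> i j. if j = \<pi> i then 1 else 0) :: real ^ 'n ^ 'n)) $ j $ k = A $ j $ inv \<pi> k"
proof -
  have "(k = \<pi> i) = (i = inv \<pi> k)" for i
    using assms by (metis bij_inv_eq_iff)
  then show ?thesis
    by (simp add: matrix_matrix_mult_def if_distrib[of "\<lambda>c. _ * c"] cong: if_cong)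
qed

lemma permutation_matrix_mult_transpose:
  fixes P :: "real ^ 'n ^ 'n"
  assumes "permutation_matrix P"
  shows "P ** transpose P = mat 1"
proof -
  obtain \<pi> where \<pi>: "bij \<pi>" "P = (\<chi> i j. if j = \<pi> i then 1 else 0)"
    using assms by (rule permutation_matrixE)
  have "(P ** transpose P) $ i $ j = mat 1 $ i $ j" for i j
    unfolding \<pi>(2) transpose_permutation_matrix[OF \<pi>(1)]
      mult_permutation_matrix_component[OF bij_imp_bij_inv[OF \<pi>(1)]]
    using \<pi>(1) by (auto simp: mat_def inv_inv_eq bij_is_inj inj_eq)
  then show ?thesis by (simp add: vec_eq_iff)
qed

lemma permutation_sparse_simplex:
  fixes T :: "real ^ 'n"
  assumes "permutation_matrix P" "T \<in> sparse_simplex s"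
  shows "P *v T \<in> sparse_simplex s"
proof -
  obtain \<pi> where \<pi>: "bij \<pi>" "P = (\<chi> i j. if j = \<pi> i then 1 else 0)"
    using assms(1) by (rule permutation_matrixE)
  have c: "(P *v T) $ i = T $ \<pi> i" for i unfolding \<pi>(2) by (rule permutation_matrix_mult_component)
  have "(\<Sum>i\<in>UNIV. T $ \<pi> i) = (\<Sum>i\<in>UNIV. T $ i)"
    by (rule sum.reindex_bij_betw) (use \<pi> in simp)
  moreover have "{i. T $ \<pi> i \<noteq> 0} = \<pi> -` {k. T $ k \<noteq> 0}" by auto
  moreover have "card (\<pi> -` {k. T $ k \<noteq> 0}) = card {k. T $ k \<noteq> 0}"
    using \<pi>(1) by (intro card_vimage_inj) (auto simp: bij_def)
  ultimately show ?thesis using assms(2) by (simp add: sparse_simplex_def prob_simplex_def c)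
qed

text \<open>
  A permutation maps the cone of \<open>S\<close> onto the cone of its relabelled version, preserving the \<open>l1\<close>
  norm and the cardinality of \<open>S\<close>. So every quotient for \<open>M ** P\<close> is also one for \<open>M\<close>.
\<close>
lemma kappa_le_kappa_permuted:
  fixes M :: "real ^ 'k ^ 'p"
  assumes P: "permutation_matrix P" and s: "1 \<le> s"
  shows "kappa M s \<le> kappa (M ** P) s"
  unfolding kappa_def
proof (rule cInf_superset_mono)
  obtain \<pi> where \<pi>: "bij \<pi>" "P = (\<chi> i j. if j = \<pi> i then 1 else 0)"
    using P by (rule permutation_matrixE)
  have c: "(P *v v) $ i = v $ \<pi> i" for v i unfolding \<pi>(2) by (rule permutation_matrix_mult_component)
  show "{l1norm (M ** P *v v) / l1norm v | S v. card S \<le> s \<and> v \<in> dominant_cone S}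
      \<subseteq> {l1norm (M *v v) / l1norm v | S v. card S \<le> s \<and> v \<in> dominant_cone S}"
  proof safe
    fix S :: "'k set" and v :: "real ^ 'k"
    assume S: "card S \<le> s" and v: "v \<in> dominant_cone S"
    have reindex: "(\<Sum>i\<in>\<pi> -` U. \<bar>v $ \<pi> i\<bar>) = (\<Sum>k\<in>U. \<bar>v $ k\<bar>)" for U
    proof (rule sum.reindex_bij_betw)
      show "bij_betw \<pi> (\<pi> -` U) U"
        using \<pi>(1) by (simp add: bij_betw_def surj_image_vimage_eq) (blast intro: inj_on_subset)
    qed
    have "P *v v \<noteq> 0"
    proof
      assume "P *v v = 0"
      then have "v $ \<pi> (inv \<pi> k) = 0" for k using c[of v "inv \<pi> k"] by simp
      then have "v = 0" using \<pi>(1) by (simp add: vec_eq_iff bij_is_surj surj_f_inv_f)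
      then show False using v by (simp add: dominant_cone_def)
    qed
    then have "P *v v \<in> dominant_cone (\<pi> -` S)"
      using v reindex[of S] reindex[of "- S"] by (simp add: dominant_cone_def c vimage_Compl)
    moreover have "card (\<pi> -` S) \<le> s"
      using S \<pi>(1) by (subst card_vimage_inj) (auto simp: bij_def)
    moreover have "l1norm (P *v v) = l1norm v"
      using reindex[of UNIV] by (simp add: l1norm_def c)
    moreover have "M ** P *v v = M *v (P *v v)" by (simp add: matrix_vector_mul_assoc)
    ultimately show "\<exists>S' v'. l1norm (M ** P *v v) / l1norm v = l1norm (M *v v') / l1norm v'
        \<and> card S' \<le> s \<and> v' \<in> dominant_cone S'"
      by metis
  qed
  show "{l1norm (M ** P *v v) / l1norm v | S v. card S \<le> s \<and> v \<in> dominant_cone S} \<noteq> {}"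
  proof -
    have "card {undefined :: 'k} \<le> s" using s by simp
    then show ?thesis using axis_in_dominant_cone[of "undefined :: 'k"] by blast
  qed
qed (rule kappa_bdd_below)

lemma kappa_permuted:
  assumes P: "permutation_matrix P" and s: "1 \<le> s"
  shows "kappa (M ** P) s = kappa M s"
  using kappa_le_kappa_permuted[OF P s, of M]
    kappa_le_kappa_permuted[OF permutation_matrix_transpose[OF P] s, of "M ** P"]
  by (simp add: matrix_mul_assoc[symmetric] permutation_matrix_mult_transpose[OF P])

lemma restrict_rows_mult: "restrict_rows U (A ** P) = restrict_rows U A ** P"
  by (simp add: restrict_rows_def matrix_matrix_mult_def vec_eq_iff)

lemma rho_permuted:
  fixes A :: "real ^ 'k ^ 'p"
  assumes "permutation_matrix P"
  shows "rho (A ** P) q = rho A q"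
proof -
  obtain \<pi> where \<pi>: "bij \<pi>" "P = (\<chi> i j. if j = \<pi> i then 1 else 0)"
    using assms by (rule permutation_matrixE)
  have "{\<bar>(A ** P) $ j $ i\<bar> | i. i \<in> UNIV} = {\<bar>A $ j $ i\<bar> | i. i \<in> UNIV}" for j
    unfolding \<pi>(2) mult_permutation_matrix_component[OF \<pi>(1)]
    using \<pi>(1) by auto (metis bij_inv_eq_iff)
  then have "infnorm ((A ** P) $ j) = infnorm (A $ j)" for j
    unfolding infnorm_cart by simp
  then show ?thesis by (simp add: rho_def)
qed

section \<open>Probability of small multinomial fluctuations\<close>

lemma sum_exists_le_sum_sum:
  fixes f :: "'c \<Rightarrow> real"
  assumes "finite C" "finite I" "\<And>c. 0 \<le> f c"
  shows "(\<Sum>c | c \<in> C \<and> (\<exists>i\<in>I. Q i c). f c) \<le> (\<Sum>i\<in>I. \<Sum>c | c \<in> C \<and> Q i c. f c)"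
proof -
  have eq: "(\<Sum>c | c \<in> C \<and> R c. f c) = (\<Sum>c\<in>C. if R c then f c else 0)" for R
    using assms(1) by (simp add: sum.inter_filter)
  have "(\<Sum>c\<in>C. if \<exists>i\<in>I. Q i c then f c else 0) \<le> (\<Sum>c\<in>C. \<Sum>i\<in>I. if Q i c then f c else 0)"
  proof (rule sum_mono)
    fix c
    show "(if \<exists>i\<in>I. Q i c then f c else 0) \<le> (\<Sum>i\<in>I. if Q i c then f c else 0)"
    proof (cases "\<exists>i\<in>I. Q i c")
      case True
      then obtain i where "i \<in> I" "Q i c" by blast
      then show ?thesis
        using member_le_sum[of i I "\<lambda>i. if Q i c then f c else 0"] assms by auto
    qed (use assms in \<open>auto intro: sum_nonneg\<close>)
  qed
  also have "\<dots> = (\<Sum>i\<in>I. \<Sum>c\<in>C. if Q i c then f c else 0)" by (rule sum.swap)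
  finally show ?thesis unfolding eq .
qed

text \<open>
  The union bound for a family of weights: applying Bernstein's inequality to \<open>f i\<close> and \<open>- f i\<close>
  accounts for the two tails.
\<close>
lemma multinomial_uniform_deviation:
  fixes q :: "real ^ 'p" and f :: "'i \<Rightarrow> 'p \<Rightarrow> real"
  assumes q: "q \<in> prob_simplex" and I: "finite I"
    and f: "\<And>i j. i \<in> I \<Longrightarrow> \<bar>f i j\<bar> \<le> b i"
    and v: "\<And>i. i \<in> I \<Longrightarrow> (\<Sum>j\<in>UNIV. q $ j * (f i j)\<^sup>2) \<le> v i" "\<And>i. i \<in> I \<Longrightarrow> 0 < v i"
    and N: "0 < N" and y: "0 \<le> y"
  shows "(\<Sum>c | c \<in> count_vectors N \<and> (\<exists>i\<in>I. sqrt (2 * v i * y) + b i * y / 3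
            \<le> \<bar>\<Sum>j\<in>UNIV. (real (c j) / real N - q $ j) * f i j\<bar>). multinomial_prob N q c)
        \<le> 2 * real (card I) * exp (- real N * y)"
proof -
  let ?Q = "\<lambda>(i, \<sigma>) c. sqrt (2 * v i * y) + b i * y / 3
      \<le> (\<Sum>j\<in>UNIV. (real (c j) / real N - q $ j) * (\<sigma> * f i j))"
  have flip: "(\<Sum>j\<in>UNIV. (real (c j) / real N - q $ j) * (\<sigma> * f i j))
      = \<sigma> * (\<Sum>j\<in>UNIV. (real (c j) / real N - q $ j) * f i j)" for c :: "'p \<Rightarrow> nat" and \<sigma> i
    by (simp add: sum_distrib_left mult_ac)
  have "(\<exists>i\<in>I. sqrt (2 * v i * y) + b i * y / 3
            \<le> \<bar>\<Sum>j\<in>UNIV. (real (c j) / real N - q $ j) * f i j\<bar>)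
      \<longleftrightarrow> (\<exists>i\<in>I \<times> {1, -1}. ?Q i c)" for c
  proof -
    have "t \<le> \<bar>z\<bar> \<longleftrightarrow> t \<le> z \<or> t \<le> - z" for t z :: real by linarith
    then show ?thesis unfolding flip by auto
  qed
  then have "(\<Sum>c | c \<in> count_vectors N \<and> (\<exists>i\<in>I. sqrt (2 * v i * y) + b i * y / 3
            \<le> \<bar>\<Sum>j\<in>UNIV. (real (c j) / real N - q $ j) * f i j\<bar>). multinomial_prob N q c)
      = (\<Sum>c | c \<in> count_vectors N \<and> (\<exists>i\<in>I \<times> {1, -1}. ?Q i c). multinomial_prob N q c)"
    by simp
  also have "\<dots> \<le> (\<Sum>i\<in>I \<times> {1, -1}. \<Sum>c | c \<in> count_vectors N \<and> ?Q i c. multinomial_prob N q c)"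
    using I by (intro sum_exists_le_sum_sum finite_count_vectors multinomial_prob_nonneg q) auto
  also have "\<dots> \<le> (\<Sum>i\<in>I \<times> {1, -1 :: real}. exp (- real N * y))"
  proof (rule sum_mono, clarify)
    fix i \<sigma> assume i: "i \<in> I" and "\<sigma> \<in> {1, -1 :: real}"
    then have \<sigma>: "\<bar>\<sigma>\<bar> = 1" "\<sigma>\<^sup>2 = 1" by auto
    have "(\<Sum>c | c \<in> count_vectors N \<and> sqrt (2 * v i * y) + b i * y / 3
        \<le> (\<Sum>j\<in>UNIV. (real (c j) / real N - q $ j) * (\<sigma> * f i j)). multinomial_prob N q c)
      \<le> exp (- real N * y)"
      by (rule multinomial_bernstein[OF q _ _ v(2)[OF i] N y])
        (use i f v in \<open>auto simp: abs_mult power_mult_distrib \<sigma>\<close>)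
    then show "(\<Sum>c | c \<in> count_vectors N \<and> sqrt (2 * v i * y) + b i * y / 3
        \<le> (\<Sum>j\<in>UNIV. (real (c j) / real N - q $ j) * (\<sigma> * f i j)). multinomial_prob N q c)
      \<le> exp (- real N * y)" .
  qed
  also have "\<dots> = 2 * real (card I) * exp (- real N * y)"
    by (simp add: card_cartesian_product)
  finally show ?thesis .
qed

lemma measure_multinomial_event:
  assumes "prob_space M" and Y: "multinomial_distributed M N q Y" and C: "C \<subseteq> count_vectors N"
  shows "{\<omega> \<in> space M. \<exists>c\<in>C. \<forall>j. Y \<omega> $ j = real (c j)} \<in> sets M"
    and "measure M {\<omega> \<in> space M. \<exists>c\<in>C. \<forall>j. Y \<omega> $ j = real (c j)} = (\<Sum>c\<in>C. multinomial_prob N q c)"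
proof -
  interpret prob_space M by fact
  define E where "E c = {\<omega> \<in> space M. \<forall>j. Y \<omega> $ j = real (c j)}" for c
  have Ym: "Y \<in> borel_measurable M" and Yp: "measure M (E c) = multinomial_prob N q c" for c
    using Y by (auto simp: multinomial_distributed_def E_def)
  have E: "E c \<in> sets M" for c
  proof -
    have "E c = Y -` {\<chi> j. real (c j)} \<inter> space M" by (auto simp: E_def vec_eq_iff)
    then show ?thesis using Ym by (auto intro: measurable_sets)
  qed
  have fin: "finite C" using C finite_count_vectors by (rule finite_subset)
  have eq: "{\<omega> \<in> space M. \<exists>c\<in>C. \<forall>j. Y \<omega> $ j = real (c j)} = (\<Union>c\<in>C. E c)"
    by (auto simp: E_def)
  show "{\<omega> \<in> space M. \<exists>c\<in>C. \<forall>j. Y \<omega> $ j = real (c j)} \<in> sets M"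
    unfolding eq using fin E by auto
  have "disjoint_family_on E C"
    by (auto simp: disjoint_family_on_def E_def fun_eq_iff)
  then show "measure M {\<omega> \<in> space M. \<exists>c\<in>C. \<forall>j. Y \<omega> $ j = real (c j)} = (\<Sum>c\<in>C. multinomial_prob N q c)"
    unfolding eq using fin E by (subst finite_measure_finite_Union) (auto simp: Yp)
qed

lemma multinomial_prob_zero:
  assumes "q $ j = 0" "c j \<noteq> 0"
  shows "multinomial_prob N q c = 0"
proof -
  have "(\<Prod>j\<in>UNIV. (q $ j) ^ c j) = 0"
    using assms by (auto intro!: prod_zero bexI[of _ j])
  then show ?thesis by (simp add: multinomial_prob_def)
qed

text \<open>
  The count vectors whose frequencies satisfy the assumptions of \<open>plugin_good_event\<close>. That cells
  of probability zero have count zero is a separate condition, as it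
  has probability 1 and needs no tail bound.
\<close>
definition good_counts :: "nat \<Rightarrow> real ^ 'k ^ 'p \<Rightarrow> real ^ 'p \<Rightarrow> ('p \<Rightarrow> nat) set" where
  "good_counts N A q = {c \<in> count_vectors N.
    (\<forall>j. q $ j = 0 \<longrightarrow> c j = 0) \<and>
    (\<forall>j\<in>J_over q. \<bar>real (c j) / real N - q $ j\<bar> \<le> eps N q j) \<and>
    (\<forall>k. \<bar>\<Sum>j\<in>UNIV. (real (c j) / real N - q $ j) * (A $ j $ k / q $ j)\<bar>
      \<le> sqrt (4 * rho A q * (ln (real CARD('p)) / real N)) + 2 / 3 * rho A q * (ln (real CARD('p)) / real N))}"

text \<open>
  The tail level \<open>y = 2 ln p / N\<close> gives each deviation the probability \<open>1 / p\<^sup>2\<close>. For the frequency of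
  cell \<open>i\<close> the weights are the indicator of \<open>i\<close>, with second moment \<open>q $ i\<close> and bound 1. For column
  \<open>k\<close> they are \<open>A $ j $ k / q $ j\<close>, bounded by \<open>rho\<close>, and so is their second moment because
  \<open>q $ j * (A $ j $ k / q $ j)\<^sup>2 \<le> rho * A $ j $ k\<close> and the column sums to 1.
\<close>
lemma good_counts_prob:
  fixes A :: "real ^ 'k ^ 'p"
  assumes cols: "\<forall>k. column k A \<in> prob_simplex" and T: "T \<in> prob_simplex" and q_eq: "q = A *v T"
    and N: "0 < N" and card: "CARD('k) \<le> CARD('p)"
  shows "1 - 4 / real CARD('p) \<le> (\<Sum>c\<in>good_counts N A q. multinomial_prob N q c)"
proof -
  define p where "p = real CARD('p)"
  define L where "L = ln p / real N"
  define y where "y = 2 * L"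
  let ?mp = "multinomial_prob N q"
  have q: "q \<in> prob_simplex" unfolding q_eq by (rule matrix_mult_simplex[OF cols T])
  have q0: "0 \<le> q $ j" for j using q by (simp add: prob_simplex_def)
  have p: "1 \<le> p" by (simp add: p_def Suc_leI)
  then have L: "0 \<le> L" by (simp add: L_def)
  have y: "0 \<le> y" using L by (simp add: y_def)
  have \<rho>: "1 \<le> rho A q" unfolding q_eq using rho_ge_1[OF T] q by (simp add: q_eq)
  have A0: "0 \<le> A $ j $ k" and A1: "(\<Sum>j\<in>UNIV. A $ j $ k) = 1" for j k
    using cols by (auto simp: prob_simplex_def column_def)
  have tail: "exp (- real N * y) = 1 / p\<^sup>2"
  proof -
    have "- real N * y = - (2 * ln p)" using N by (simp add: y_def L_def)
    also have "\<dots> = - ln (p\<^sup>2)" using p by (simp add: ln_realpow)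
    finally show ?thesis using p by (simp add: exp_minus inverse_eq_divide)
  qed
  let ?f1 = "\<lambda>i j. if j = i then 1 else 0 :: real"
  let ?Q1 = "\<lambda>c. \<exists>i\<in>J_over q. sqrt (2 * q $ i * y) + 1 * y / 3
      \<le> \<bar>\<Sum>j\<in>UNIV. (real (c j) / real N - q $ j) * ?f1 i j\<bar>"
  have dev1: "(\<Sum>c | c \<in> count_vectors N \<and> ?Q1 c. ?mp c) \<le> 2 * real (card (J_over q)) * exp (- real N * y)"
    by (rule multinomial_uniform_deviation[OF q _ _ _ _ N y, where b = "\<lambda>_. 1"])
      (auto simp: J_over_def if_distrib[of "\<lambda>c. c\<^sup>2"] if_distrib[of "\<lambda>c. _ * c"] cong: if_cong)
  let ?f2 = "\<lambda>k j. A $ j $ k / q $ j"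
  have f2: "\<bar>?f2 k j\<bar> \<le> rho A q" for k j
  proof (cases "q $ j = 0")
    case False
    then have qj: "0 < q $ j" using q0[of j] by simp
    have "A $ j $ k \<le> rho A q * q $ j"
      using component_le_infnorm_cart[of "A $ j" k] infnorm_row_le_rho[where q = q and A = A, OF qj] by linarith
    then show ?thesis using qj A0[of j k] by (simp add: pos_divide_le_eq)
  qed (use \<rho> in simp)
  let ?Q2 = "\<lambda>c. \<exists>k\<in>UNIV. sqrt (2 * rho A q * y) + rho A q * y / 3
      \<le> \<bar>\<Sum>j\<in>UNIV. (real (c j) / real N - q $ j) * ?f2 k j\<bar>"
  have dev2: "(\<Sum>c | c \<in> count_vectors N \<and> ?Q2 c. ?mp c) \<le> 2 * real CARD('k) * exp (- real N * y)"
  proof (rule multinomial_uniform_deviation[OF q _ f2 _ _ N y])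
    fix k
    have "q $ j * (?f2 k j)\<^sup>2 \<le> rho A q * A $ j $ k" for j
    proof (cases "q $ j = 0")
      case False
      then have "q $ j * (?f2 k j)\<^sup>2 = ?f2 k j * A $ j $ k" by (simp add: power2_eq_square)
      also have "\<dots> \<le> rho A q * A $ j $ k"
        using f2[of j k] by (intro mult_right_mono A0) linarith
      finally show ?thesis .
    qed (use \<rho> A0 in simp)
    then have "(\<Sum>j\<in>UNIV. q $ j * (?f2 k j)\<^sup>2) \<le> (\<Sum>j\<in>UNIV. rho A q * A $ j $ k)"
      by (rule sum_mono)
    then show "(\<Sum>j\<in>UNIV. q $ j * (?f2 k j)\<^sup>2) \<le> rho A q"
      by (simp add: sum_distrib_left[symmetric] A1)
  qed (use \<rho> in auto)
  have bad: "?Q1 c \<or> ?Q2 c \<or> ?mp c = 0" if c: "c \<in> count_vectors N - good_counts N A q" for c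
  proof (rule ccontr)
    assume neg: "\<not> ?thesis"
    have "\<bar>real (c i) / real N - q $ i\<bar> \<le> eps N q i" if i: "i \<in> J_over q" for i
    proof -
      have "\<bar>real (c i) / real N - q $ i\<bar> < sqrt (2 * q $ i * y) + y / 3"
        using neg i by (auto simp: not_le if_distrib[of "\<lambda>c. _ * c"] cong: if_cong)
      also have "sqrt (2 * q $ i * y) = sqrt (2\<^sup>2 * (q $ i * L))" by (simp add: y_def mult_ac)
      also have "\<dots> = 2 * sqrt (q $ i * L)" by (simp only: real_sqrt_mult) simp
      finally have "\<bar>real (c i) / real N - q $ i\<bar> < 2 * sqrt (q $ i * L) + 2 / 3 * L"
        by (simp add: y_def)
      moreover have "eps N q i = 2 * sqrt (q $ i * L) + 4 / 3 * L"
        by (simp add: eps_def L_def p_def)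
      ultimately show ?thesis using L by linarith
    qed
    moreover have "\<bar>\<Sum>j\<in>UNIV. (real (c j) / real N - q $ j) * ?f2 k j\<bar>
        \<le> sqrt (4 * rho A q * L) + 2 / 3 * rho A q * L" for k
      using neg by (auto simp: not_le y_def mult_ac intro: less_imp_le)
    moreover have "\<forall>j. q $ j = 0 \<longrightarrow> c j = 0" using neg multinomial_prob_zero[of q _ c N] by blast
    ultimately have "c \<in> good_counts N A q" using c unfolding good_counts_def L_def p_def by blast
    then show False using c by blast
  qed
  have "(\<Sum>c\<in>count_vectors N - good_counts N A q. ?mp c)
      \<le> (\<Sum>c | c \<in> count_vectors N \<and> (\<exists>i\<in>{True, False}. if i then ?Q1 c else ?Q2 c). ?mp c)"
  proof -
    have "(\<Sum>c\<in>count_vectors N - good_counts N A q. ?mp c)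
      = (\<Sum>c | c \<in> count_vectors N - good_counts N A q \<and> (?Q1 c \<or> ?Q2 c). ?mp c)"
      using bad by (intro sum.mono_neutral_right) (auto simp: finite_count_vectors)
    also have "\<dots> \<le> (\<Sum>c | c \<in> count_vectors N \<and> (\<exists>i\<in>{True, False}. if i then ?Q1 c else ?Q2 c). ?mp c)"
      by (intro sum_mono2) (auto simp: finite_count_vectors multinomial_prob_nonneg[OF q])
    finally show ?thesis .
  qed
  also have "\<dots> \<le> (\<Sum>i\<in>{True, False}. \<Sum>c | c \<in> count_vectors N \<and> (if i then ?Q1 c else ?Q2 c). ?mp c)"
    by (intro sum_exists_le_sum_sum finite_count_vectors multinomial_prob_nonneg q) auto
  also have "\<dots> = (\<Sum>c | c \<in> count_vectors N \<and> ?Q1 c. ?mp c) + (\<Sum>c | c \<in> count_vectors N \<and> ?Q2 c. ?mp c)"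
    by simp
  also have "\<dots> \<le> 2 * real (card (J_over q)) * (1 / p\<^sup>2) + 2 * real CARD('k) * (1 / p\<^sup>2)"
    using dev1 dev2 unfolding tail by (rule add_mono)
  also have "\<dots> \<le> 2 * p * (1 / p\<^sup>2) + 2 * p * (1 / p\<^sup>2)"
    using card card_mono[of "UNIV :: 'p set" "J_over q"]
    by (intro add_mono mult_right_mono mult_left_mono) (auto simp: p_def)
  also have "\<dots> = 4 / p" using p by (simp add: field_simps power2_eq_square)
  finally have "(\<Sum>c\<in>count_vectors N - good_counts N A q. ?mp c) \<le> 4 / p" .
  moreover have "(\<Sum>c\<in>count_vectors N - good_counts N A q. ?mp c) = 1 - (\<Sum>c\<in>good_counts N A q. ?mp c)"
    using sum_multinomial_prob[OF q, of N]
    by (subst sum_diff) (auto simp: finite_count_vectors good_counts_def)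
  ultimately show ?thesis by (simp add: p_def)
qed

section \<open>Measurability and the bound in probability\<close>

lemma measurable_max_col_l1norm:
  "(\<lambda>B. max_col_l1norm (restrict_rows U B - C)) \<in> borel_measurable (borel :: (real ^ 'k ^ 'p) measure)"
proof -
  have "(\<lambda>B. l1norm (column k (restrict_rows U B - C))) \<in> borel_measurable (borel :: (real ^ 'k ^ 'p) measure)" for k
  proof (rule borel_measurable_continuous_onI)
    have "continuous_on UNIV (\<lambda>B :: real ^ 'k ^ 'p. \<bar>(if j \<in> U then B $ j $ k else 0) - C $ j $ k\<bar>)" for j
      by (cases "j \<in> U") (auto intro!: continuous_intros)
    then show "continuous_on UNIV (\<lambda>B :: real ^ 'k ^ 'p. l1norm (column k (restrict_rows U B - C)))"
      by (auto simp: l1norm_def column_def restrict_rows_def if_distrib[of "\<lambda>v. v $ _"] intro!: continuous_on_sum cong: if_cong)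
  qed
  then show ?thesis
    unfolding max_col_l1norm_def by (intro borel_measurable_Max) auto
qed

lemma measurable_infnorm_row:
  "(\<lambda>B. infnorm (B $ j - v)) \<in> borel_measurable (borel :: (real ^ 'k ^ 'p) measure)"
  by (intro borel_measurable_continuous_onI continuous_intros)

lemma measurable_l1norm_diff:
  "(\<lambda>T. l1norm (T - v)) \<in> borel_measurable (borel :: (real ^ 'k) measure)"
  unfolding l1norm_def by (intro borel_measurable_continuous_onI continuous_intros)

theorem theorem8:
  fixes M :: "'a measure"
    and N s :: nat
    and \<alpha> :: real
    and A :: "real ^ 'k ^ 'p"
    and P :: "real ^ 'k ^ 'k"
    and Tstar :: "real ^ 'k"
    and Pistar :: "real ^ 'p"
    and X :: "'a \<Rightarrow> real ^ 'p"
    and Ahat :: "'a \<Rightarrow> real ^ 'k ^ 'p"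
    and That :: "'a \<Rightarrow> real ^ 'k"
  assumes "prob_space M"
    and "CARD('k) < CARD('p)"
    and "N \<ge> 1"
    and "\<forall>k. column k A \<in> prob_simplex"
    and "1 \<le> s" and "s \<le> CARD('k)"
    and "Tstar \<in> sparse_simplex s"
    and "Pistar = A *v Tstar"
    and "X \<in> borel_measurable M"
    and "multinomial_distributed M N Pistar (\<lambda>\<omega>. real N *\<^sub>R X \<omega>)"
    and "Ahat \<in> borel_measurable M"
    and "\<forall>\<omega>\<in>space M. \<forall>k. column k (Ahat \<omega>) \<in> prob_simplex"
    and "That \<in> borel_measurable M"
    and "\<forall>\<omega>\<in>space M.
           is_arg_max (plugin_loglik N (X \<omega>) (Ahat \<omega>)) (\<lambda>T. T \<in> prob_simplex) (That \<omega>)"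
    and "permutation_matrix P"
    and "measure M {\<omega> \<in> space M.
           (\<forall>j\<in>J_over Pistar. infnorm (Ahat \<omega> $ j - (A ** P) $ j) \<le> Pistar $ j / 2) \<and>
           max_col_l1norm (restrict_rows (J_under N Pistar) (Ahat \<omega>)
               - restrict_rows (J_under N Pistar) (A ** P))
             \<le> kappa (restrict_rows (J_under N Pistar) A) s / 2}
         \<ge> 1 - \<alpha>"
  shows "measure M {\<omega> \<in> space M.
           ereal (l1norm (That \<omega> - transpose P *v Tstar)) \<le>
           (if kappa (restrict_rows (J_under N Pistar) A) s = 0 then \<infinity>
            else ereal (3 / (kappa (restrict_rows (J_under N Pistar) A) s)\<^sup>2 *
              (sqrt (2 * rho A Pistar * ln (real CARD('p)) / real N)
               + 2 * rho A Pistar * ln (real CARD('p)) / (3 * real N)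
               + 16 * rho A Pistar *
                   max_col_l1norm (restrict_rows (J_over Pistar) (Ahat \<omega>)
                     - restrict_rows (J_over Pistar) (A ** P))
               + 56 / 3 * rho A Pistar *
                   (\<Sum>j\<in>J_over Pistar - J_under N Pistar.
                      infnorm (Ahat \<omega> $ j - (A ** P) $ j) / Pistar $ j
                        * (ln (real CARD('p)) / real N)))))}
         \<ge> 1 - 4 / real CARD('p) - \<alpha>"
proof -
  interpret prob_space M by fact
  define q where "q = Pistar"
  define Ju where "Ju = J_under N q"
  define \<kappa> where "\<kappa> = kappa (restrict_rows Ju A) s"
  define Row where "Row \<omega> \<longleftrightarrow> (\<forall>j\<in>J_over q. infnorm (Ahat \<omega> $ j - (A ** P) $ j) \<le> q $ j / 2)" for \<omega>
  define Cols where "Cols \<omega> \<longleftrightarrow>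
    max_col_l1norm (restrict_rows Ju (Ahat \<omega>) - restrict_rows Ju (A ** P)) \<le> \<kappa> / 2" for \<omega>
  define bound where "bound \<omega> = 3 / \<kappa>\<^sup>2 *
              (sqrt (2 * rho A q * ln (real CARD('p)) / real N)
               + 2 * rho A q * ln (real CARD('p)) / (3 * real N)
               + 16 * rho A q *
                   max_col_l1norm (restrict_rows (J_over q) (Ahat \<omega>)
                     - restrict_rows (J_over q) (A ** P))
               + 56 / 3 * rho A q *
                   (\<Sum>j\<in>J_over q - Ju.
                      infnorm (Ahat \<omega> $ j - (A ** P) $ j) / q $ j
                        * (ln (real CARD('p)) / real N)))" for \<omega>
  \<comment> \<open>\<open>E\<close> is the event of the hypothesis and \<open>F\<close> that of the conclusion. \<open>G\<close> is described by count vectors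
    because it is then a finite disjoint union of events whose probabilities are known exactly.\<close>
  define E where "E = {\<omega> \<in> space M. Row \<omega> \<and> Cols \<omega>}"
  define G where "G = {\<omega> \<in> space M. \<exists>c\<in>good_counts N A q. \<forall>j. (real N *\<^sub>R X \<omega>) $ j = real (c j)}"
  define F where "F = {\<omega> \<in> space M. ereal (l1norm (That \<omega> - transpose P *v Tstar))
      \<le> (if \<kappa> = 0 then \<infinity> else ereal (bound \<omega>))}"
  note defs = q_def Ju_def \<kappa>_def

  have N: "0 < N" using assms(3) by simp
  have Tstar: "Tstar \<in> prob_simplex" using assms(7) by (simp add: sparse_simplex_def)
  have q_eq: "q = A *v Tstar" using assms(8) by (simp add: q_def)
  have mult: "multinomial_distributed M N q (\<lambda>\<omega>. real N *\<^sub>R X \<omega>)" using assms(10) by (simp add: q_def)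
  have P: "permutation_matrix P" by fact
  obtain \<pi> where \<pi>: "bij \<pi>" "P = (\<chi> i j. if j = \<pi> i then 1 else 0)"
    using P by (rule permutation_matrixE)
  have AP: "(A ** P) $ j $ k = A $ j $ inv \<pi> k" for j k
    unfolding \<pi>(2) by (rule mult_permutation_matrix_component[OF \<pi>(1)])
  have Ahat: "Ahat \<in> borel_measurable M" and That: "That \<in> borel_measurable M" by fact+
  have m1: "(\<lambda>\<omega>. max_col_l1norm (restrict_rows U (Ahat \<omega>) - C)) \<in> borel_measurable M" for U C
    by (rule measurable_compose[OF Ahat measurable_max_col_l1norm])
  have m2: "(\<lambda>\<omega>. infnorm (Ahat \<omega> $ j - v)) \<in> borel_measurable M" for j v
    by (rule measurable_compose[OF Ahat measurable_infnorm_row])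
  have m3: "(\<lambda>\<omega>. l1norm (That \<omega> - v)) \<in> borel_measurable M" for v
    by (rule measurable_compose[OF That measurable_l1norm_diff])
  have E: "E \<in> sets M"
    unfolding E_def Row_def Cols_def using m1 m2 by measurable
  have F: "F \<in> sets M"
  proof (cases "\<kappa> = 0")
    case False
    have "bound \<in> borel_measurable M" unfolding bound_def using m1 m2 by measurable
    then show ?thesis using False m3 unfolding F_def by simp
  qed (simp add: F_def)
  have good_subset: "good_counts N A q \<subseteq> count_vectors N" by (auto simp: good_counts_def)
  have G: "G \<in> sets M"
    unfolding G_def by (rule measure_multinomial_event(1)[OF assms(1) mult good_subset])
  have "1 - 4 / real CARD('p) \<le> measure M G"
    unfolding G_def measure_multinomial_event(2)[OF assms(1) mult good_subset]
    by (rule good_counts_prob[OF assms(4) Tstar q_eq N]) (use assms(2) in simp)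
  moreover have "1 - \<alpha> \<le> measure M E"
    using assms(16) by (simp add: E_def Row_def Cols_def defs)
  moreover have "measure M E + measure M G - 1 \<le> measure M (E \<inter> G)"
  proof -
    have "measure M (E \<union> G) = measure M E + measure M G - measure M (E \<inter> G)"
      using E G by (simp add: finite_measure_Union' finite_measure_Diff' Int_commute)
    then show ?thesis using prob_le_1[of "E \<union> G"] by linarith
  qed
  moreover have "measure M (E \<inter> G) \<le> measure M F"
  proof (rule finite_measure_mono[OF _ F], rule subsetI)
    fix \<omega> assume "\<omega> \<in> E \<inter> G"
    then have \<omega>: "\<omega> \<in> space M" and row: "Row \<omega>"
      and "\<exists>c\<in>good_counts N A q. \<forall>j. (real N *\<^sub>R X \<omega>) $ j = real (c j)"
      by (auto simp: E_def G_def)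
    then obtain c where c: "c \<in> good_counts N A q" and "\<And>j. (real N *\<^sub>R X \<omega>) $ j = real (c j)"
      by blast
    then have x: "X \<omega> $ j = real (c j) / real N" for j using N by (simp add: field_simps)
    have q0: "0 \<le> q $ j" for j using matrix_mult_simplex[OF assms(4) Tstar] by (simp add: q_eq prob_simplex_def)
    have dev: "\<bar>X \<omega> $ j - q $ j\<bar> \<le> eps N q j" for j
    proof (cases "j \<in> J_over q")
      case True
      then show ?thesis using c by (simp add: good_counts_def x)
    next
      case False
      then have "q $ j = 0" using q0[of j] by (simp add: J_over_def)
      moreover from this have "c j = 0" using c by (simp add: good_counts_def)
      ultimately show ?thesis using eps_nonneg[where q = q and j = j and N = N] by (simp add: x)
    qed
    have \<rho>: "rho (A ** P) q = rho A q" by (rule rho_permuted[OF P])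
    \<comment> \<open>On \<open>E \<inter> G\<close> the deterministic bound applies to the relabelled matrix \<open>A ** P\<close> and weights
      \<open>transpose P *v Tstar\<close>, whose product is still \<open>q\<close>.\<close>
    interpret plugin_good_event N s "A ** P" "Ahat \<omega>" "transpose P *v Tstar" "That \<omega>" q "X \<omega>"
    proof
      show "0 < N" "1 \<le> s" by fact+
      show "\<forall>k. column k (A ** P) \<in> prob_simplex"
        using assms(4) by (simp add: column_def AP)
      show "\<forall>k. column k (Ahat \<omega>) \<in> prob_simplex" using assms(12) \<omega> by blast
      show "transpose P *v Tstar \<in> sparse_simplex s"
        by (rule permutation_sparse_simplex[OF permutation_matrix_transpose[OF P] assms(7)])
      show "q = A ** P *v (transpose P *v Tstar)"
        unfolding q_eq matrix_vector_mul_assoc matrix_mul_assoc[symmetric]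
          permutation_matrix_mult_transpose[OF P] by simp
      show "is_arg_max (plugin_loglik N (X \<omega>) (Ahat \<omega>)) (\<lambda>T. T \<in> prob_simplex) (That \<omega>)"
        using assms(14) \<omega> by blast
      show "infnorm (Ahat \<omega> $ j - (A ** P) $ j) \<le> q $ j / 2" if "j \<in> J_over q" for j
        using row that by (simp add: Row_def)
      show "0 \<le> X \<omega> $ j" for j by (simp add: x)
      show "X \<omega> $ j = 0" if "j \<notin> J_over q" for j
      proof -
        have "q $ j = 0" using that q0[of j] by (simp add: J_over_def)
        then show ?thesis using c by (simp add: good_counts_def x)
      qed
      show "X \<omega> $ j \<le> q $ j + eps N q j" "q $ j - eps N q j \<le> X \<omega> $ j" for j
        using dev[of j] by (simp_all add: abs_le_iff)
      show "\<bar>\<Sum>j\<in>UNIV. (X \<omega> $ j - q $ j) * ((A ** P) $ j $ k / q $ j)\<bar>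
          \<le> sqrt (4 * rho (A ** P) q * (ln (real CARD('p)) / real N))
            + 2 / 3 * rho (A ** P) q * (ln (real CARD('p)) / real N)" for k
        unfolding \<rho> AP x using c by (simp add: good_counts_def)
    qed
    have \<kappa>_eq: "kappa (restrict_rows (J_under N q) (A ** P)) s = \<kappa>"
      by (simp add: restrict_rows_mult kappa_permuted[OF P assms(5)] \<kappa>_def Ju_def)
    have "l1norm (That \<omega> - transpose P *v Tstar) \<le> bound \<omega>" if "\<kappa> \<noteq> 0"
      using plugin_error_le that
      unfolding \<kappa>_eq \<rho> bound_def err_def col_err_def small_row_err_def log_rate_def Ju_def
      by (simp add: mult_ac)
    then show "\<omega> \<in> F" using \<omega> by (auto simp: F_def)
  qed
  ultimately have "1 - 4 / real CARD('p) - \<alpha> \<le> measure M F" by linarith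
  then show ?thesis by (simp only: F_def bound_def defs)
qed

end
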